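(* Under the standing hypotheses described in the context, the $(q-1)$-secants to $D$ in $H_\infty=\mathrm{PG}(2k-1,q)$ form a pseudoregulus: they are $\frac{q^k-1}{q-1}$ pairwise disjoint lines, and there exist exactly two $(k-1)$-dimensional subspaces of $H_\infty$ disjoint from $D$, each meeting every $(q-1)$-secant to $D$. In particular, $D$ is an $\mathbb{F}_2$-linear set of pseudoregulus type.
   Context: Standing hypotheses: $q=2^h$ with $h\ge4$, $k\ge2$; $H_\infty\cong\mathrm{PG}(2k-1,q)$ is a hyperplane of $\mathrm{PG}(2k,q)$, points outside $H_\infty$ are affine; for distinct affine points $P,R$ the point $PR\cap H_\infty$ is the direction they determine. $\mathcal{Q}$ is a set of $q^k$ affine points, $D\subseteq H_\infty$ is the set of directions determined by pairs of distinct points of $\mathcal{Q}$, $|D|=q^k-1$, and every line of $\mathrm{PG}(2k,q)$ meets $D$ in $0$, $1$, $3$ or $q-1$ points. A $(q-1)$-secant to $D$ is a line meeting $D$ in exactly $q-1$ points. Writing $H_\infty=\mathrm{PG}(\mathbb{F}_q^{2k})$: an $\mathbb{F}_2$-linear set is $\{\langle u\rangle_{\mathbb{F}_q}:u\in U\setminus\{0\}\}$ for an $\mathbb{F}_2$-subspace $U$; of rank $\dim_{\mathbb{F}_2}U$; scattered if it has $2^{\dim U}-1$ points. A scattered $\mathbb{F}_2$-linear set $S$ of rank $hk$ is of pseudoregulus type if there are $\frac{q^k-1}{q-1}$ pairwise disjoint lines each meeting $S$ in $q-1$ points, and exactly two $(k-1)$-spaces disjoint from $S$ meeting all these lines. 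*)

theory Defs
  imports "HOL-Analysis.Cartesian_Space" "HOL-Library.Z2"
begin

text \<open>
  Projective geometry over the vector space \<open>'a ^ 'n\<close>: a projective subspace is identified
  with the underlying linear subspace, so that a point is a one-dimensional linear subspace,
  incidence is inclusion, and the projective dimension is one less than the linear one.
\<close>

definition proj_space :: "nat \<Rightarrow> ('a::field ^ 'n) set \<Rightarrow> bool" where
  "proj_space m S \<longleftrightarrow> vec.subspace S \<and> vec.dim S = m + 1"

abbreviation proj_point :: "('a::field ^ 'n) set \<Rightarrow> bool" where
  "proj_point \<equiv> proj_space 0"

abbreviation proj_line :: "('a::field ^ 'n) set \<Rightarrow> bool" where
  "proj_line \<equiv> proj_space 1"

definition points_of :: "('a::field ^ 'n) set \<Rightarrow> ('a ^ 'n) set set" where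
  "points_of S = {P. proj_point P \<and> P \<subseteq> S}"

definition affine_points :: "('a::field ^ 'n) set \<Rightarrow> ('a ^ 'n) set set" where
  "affine_points H = {P. proj_point P \<and> \<not> P \<subseteq> H}"

text \<open>The linear span of two distinct points is the line joining them.\<close>

definition direction ::
    "('a::field ^ 'n) set \<Rightarrow> ('a ^ 'n) set \<Rightarrow> ('a ^ 'n) set \<Rightarrow> ('a ^ 'n) set" where
  "direction H P R = vec.span (P \<union> R) \<inter> H"

definition directions :: "('a::field ^ 'n) set \<Rightarrow> ('a ^ 'n) set set \<Rightarrow> ('a ^ 'n) set set" where
  "directions H Q = {direction H P R | P R. P \<in> Q \<and> R \<in> Q \<and> P \<noteq> R}"

definition secants :: "nat \<Rightarrow> ('a::field ^ 'n) set set \<Rightarrow> ('a ^ 'n) set set" where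
  "secants m S = {L. proj_line L \<and> card (points_of L \<inter> S) = m}"

text \<open>
  Scalar multiplication by the two-element field; it is a vector space structure exactly
  when the characteristic is 2.
\<close>

definition f2_scale :: "bit \<Rightarrow> 'a::field ^ 'n \<Rightarrow> 'a ^ 'n" where
  "f2_scale c v = (if c = 0 then 0 else v)"

lemma vector_space_f2_scale:
  assumes "(1::'a::field) + 1 = 0"
  shows "vector_space (f2_scale :: bit \<Rightarrow> 'a ^ 'n \<Rightarrow> 'a ^ 'n)"
proof
  fix a b :: bit and x y :: "'a ^ 'n"
  have "x $ i + x $ i = (1 + 1) * x $ i" for i
    by (simp add: distrib_right del: one_add_one)
  then have "x + x = 0"
    by (simp add: vec_eq_iff assms del: one_add_one)
  then show "f2_scale (a + b) x = f2_scale a x + f2_scale b x"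
    by (cases a; cases b) (simp_all add: f2_scale_def)
qed (simp_all add: f2_scale_def)

definition f2_subspace :: "('a::field ^ 'n) set \<Rightarrow> bool" where
  "f2_subspace U \<longleftrightarrow> module.subspace f2_scale U"

definition f2_dim :: "('a::field ^ 'n) set \<Rightarrow> nat" where
  "f2_dim U = vector_space.dim f2_scale U"

definition points_spanned_by :: "('a::field ^ 'n) set \<Rightarrow> ('a ^ 'n) set set" where
  "points_spanned_by U = {vec.span {u} | u. u \<in> U - {0}}"

text \<open>\<open>S\<close> is a scattered \<open>\<bbbF>\<^sub>2\<close>-linear set of rank \<open>r\<close> in the projective space \<open>H\<close>.\<close>

definition scattered_f2_linear_set ::
    "('a::field ^ 'n) set \<Rightarrow> nat \<Rightarrow> ('a ^ 'n) set set \<Rightarrow> bool" where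
  "scattered_f2_linear_set H r S \<longleftrightarrow>
    (\<exists>U. U \<subseteq> H \<and> f2_subspace U \<and> f2_dim U = r \<and>
         S = points_spanned_by U \<and> card S = 2 ^ r - 1)"

definition transversal_spaces ::
    "('a::field ^ 'n) set \<Rightarrow> nat \<Rightarrow> ('a ^ 'n) set set \<Rightarrow> ('a ^ 'n) set set \<Rightarrow> ('a ^ 'n) set set" where
  "transversal_spaces H k S \<L> =
    {T. proj_space (k - 1) T \<and> T \<subseteq> H \<and> points_of T \<inter> S = {} \<and>
        (\<forall>L\<in>\<L>. points_of T \<inter> points_of L \<noteq> {})}"

text \<open>
  The set of lines \<open>\<L>\<close> is a pseudoregulus for the point set \<open>S\<close> in \<open>H\<close>, where
  \<open>H\<close> is meant to be a \<open>(2k-1)\<close>-space over the field with \<open>q = CARD('a)\<close> elements.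
  The division is exact.
\<close>

definition pseudoregulus ::
    "('a::{field,finite} ^ 'n) set \<Rightarrow> nat \<Rightarrow> ('a ^ 'n) set set \<Rightarrow> ('a ^ 'n) set set \<Rightarrow> bool" where
  "pseudoregulus H k S \<L> \<longleftrightarrow>
    (\<forall>L\<in>\<L>. proj_line L \<and> L \<subseteq> H \<and> card (points_of L \<inter> S) = CARD('a) - 1) \<and>
    card \<L> = (CARD('a) ^ k - 1) div (CARD('a) - 1) \<and>
    pairwise (\<lambda>L M. points_of L \<inter> points_of M = {}) \<L> \<and>
    card (transversal_spaces H k S \<L>) = 2"

definition pseudoregulus_type ::
    "('a::{field,finite} ^ 'n) set \<Rightarrow> nat \<Rightarrow> nat \<Rightarrow> ('a ^ 'n) set set \<Rightarrow> bool" where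
  "pseudoregulus_type H h k S \<longleftrightarrow>
    scattered_f2_linear_set H (h * k) S \<and> (\<exists>\<L>. pseudoregulus H k S \<L>)"

end

theory Submission
  imports Defs
begin

text \<open>
  Choose a vector \<open>e\<close> outside \<open>H\<close> and identify \<open>Q\<close> with a set \<open>A\<close> of vectors of \<open>H\<close>, so that \<open>D\<close>
  consists of the points spanned by differences of elements of \<open>A\<close>. Counting the planes through a
  line with three points of \<open>A\<close> shows that there is no such line; hence for each \<open>a \<in> A\<close> the
  differences \<open>b - a\<close> run through \<open>D\<close> bijectively. Two intersecting \<open>(q-1)\<close>-secants would span a
  plane all of whose lines are \<open>(q-1)\<close>-secants, which is absurd. A 3-secant closes three points of
  \<open>A\<close> to a parallelogram, and as there is at most one \<open>(q-1)\<close>-secant through a point of \<open>D\<close>, any two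
  points of \<open>A\<close> are connected through such parallelograms: a translate \<open>U\<close> of \<open>A\<close> is additive.

  Since \<open>U\<close> is scattered, it meets \<open>l U\<close> trivially for scalars \<open>l \<noteq> 0, 1\<close>; as \<open>|U|\<^sup>2 = |H|\<close>, this
  bound, applied modulo a point of \<open>D\<close>, yields a \<open>(q-1)\<close>-secant through every point of \<open>D\<close>, and
  likewise inside the solid spanned by two \<open>(q-1)\<close>-secants \<open>L\<close> and \<open>M\<close>. A third \<open>(q-1)\<close>-secant in
  that solid is the graph of a linear bijection from \<open>L\<close> to \<open>M\<close> that respects \<open>U\<close>, so it matches the
  two points of \<open>L\<close> outside \<open>D\<close> with those of \<open>M\<close>. All graphs induce the same matching, and the
  matchings of different pairs are compatible; the two classes of matched points are the two
  transversal spaces.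
\<close>

section \<open>Subspaces over a finite field\<close>

text \<open>Coordinates with respect to \<open>B\<close> put coefficient functions in bijection with
  the span. The scalar multiplication is arbitrary because the lemma serves both the field of the
  geometry and \<open>f2_scale\<close>.\<close>

lemma card_span_independent:
  fixes scale :: "'a::field \<Rightarrow> 'b::ab_group_add \<Rightarrow> 'b"
  assumes "vector_space scale" "finite B" "\<not> module.dependent scale B"
  shows "card (module.span scale B) = CARD('a) ^ card B"
proof -
  interpret vector_space scale by fact
  let ?f = "\<lambda>c. \<Sum>b\<in>B. scale (c b) b"
  have "bij_betw ?f (PiE B (\<lambda>_. UNIV)) (span B)"
  proof (rule bij_betw_imageI)
    show "inj_on ?f (PiE B (\<lambda>_. UNIV))"
    proof (rule inj_onI)
      fix c d :: "'b \<Rightarrow> 'a"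
      assume c: "c \<in> PiE B (\<lambda>_. UNIV)" and d: "d \<in> PiE B (\<lambda>_. UNIV)" and eq: "?f c = ?f d"
      have "(\<Sum>b\<in>B. scale (c b - d b) b) = 0"
        using eq by (simp add: scale_left_diff_distrib sum_subtractf)
      then have "\<forall>b\<in>B. c b - d b = 0"
        using assms(3) independentD[OF assms(3,2) subset_refl, of "\<lambda>b. c b - d b"] by simp
      then show "c = d"
        using c d by (intro PiE_ext[of c B _ d]) auto
    qed
    show "?f ` (PiE B (\<lambda>_. UNIV)) = span B"
    proof
      show "?f ` (PiE B (\<lambda>_. UNIV)) \<subseteq> span B"
        by (auto intro!: span_sum intro: span_scale span_base)
      show "span B \<subseteq> ?f ` (PiE B (\<lambda>_. UNIV))"
      proof
        fix x assume "x \<in> span B"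
        then obtain u where "x = ?f u" using span_finite[OF assms(2)] by auto
        then have "x = ?f (restrict u B)" by simp
        then show "x \<in> ?f ` (PiE B (\<lambda>_. UNIV))" by (intro image_eqI[of x ?f "restrict u B"]) simp_all
      qed
    qed
  qed
  then have "card (PiE B (\<lambda>_. UNIV :: 'a set)) = card (span B)"
    by (rule bij_betw_same_card)
  then show ?thesis by (simp add: card_PiE assms(2))
qed

lemma card_subspace_dim:
  fixes scale :: "'a::field \<Rightarrow> 'b::ab_group_add \<Rightarrow> 'b"
  assumes "vector_space scale" "finite S" "module.subspace scale S"
  shows "card S = CARD('a) ^ vector_space.dim scale S"
proof -
  interpret vector_space scale by fact
  obtain B where B: "B \<subseteq> S" "independent B" "S \<subseteq> span B" "card B = dim S"
    using basis_exists by blast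
  have "span B = S" using B span_minimal[OF B(1) assms(3)] by blast
  then show ?thesis
    using card_span_independent[OF assms(1) finite_subset[OF B(1) assms(2)] B(2)] B(4) by simp
qed

lemma card_subspace:
  fixes S :: "('a::{field,finite} ^ 'n) set"
  assumes "vec.subspace S"
  shows "card S = CARD('a) ^ vec.dim S"
  using card_subspace_dim[OF vec.vector_space_axioms _ assms] by simp

lemma card_le_fibres:
  assumes "finite X" "\<And>y. y \<in> f ` X \<Longrightarrow> card {x \<in> X. f x = y} \<le> c"
  shows "card X \<le> card (f ` X) * c"
proof -
  have "X = (\<Union>y\<in>f ` X. {x \<in> X. f x = y})" by auto
  then have "card X \<le> (\<Sum>y\<in>f ` X. card {x \<in> X. f x = y})"
    using card_UN_le[of "f ` X" "\<lambda>y. {x \<in> X. f x = y}"] assms(1) by simp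
  also have "\<dots> \<le> card (f ` X) * c"
    using sum_bounded_above[of "f ` X" "\<lambda>y. card {x \<in> X. f x = y}" c] assms(2) by simp
  finally show ?thesis .
qed

section \<open>Points and lines as linear subspaces\<close>

lemma span_singleton_eq:
  fixes x y :: "'a::field ^ 'n"
  assumes "y \<in> vec.span {x}" "y \<noteq> 0"
  shows "vec.span {y} = vec.span {x}"
proof -
  obtain c where c: "y = c *s x" using assms(1) by (auto simp: vec.span_singleton)
  then have "c \<noteq> 0" using assms(2) by auto
  then have "x = inverse c *s y" using c by (simp add: vec.scale_scale)
  then have "x \<in> vec.span {y}" by (auto simp: vec.span_singleton)
  then show ?thesis using assms(1)
    by (intro subset_antisym vec.span_minimal vec.subspace_span) auto
qed

lemma in_span_singleton: "x \<in> vec.span {y :: 'a::field ^ 'n} \<longleftrightarrow> (\<exists>c. x = c *s y)"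
  by (auto simp: vec.span_singleton)

lemma span_singleton_subset_iff:
  fixes x :: "'a::field ^ 'n"
  assumes "vec.subspace W"
  shows "vec.span {x} \<subseteq> W \<longleftrightarrow> x \<in> W"
  using assms by (metis empty_subsetI insert_subset singletonI subset_iff vec.span_base vec.span_minimal)

lemma card_span_singleton:
  fixes x :: "'a::{field,finite} ^ 'n"
  assumes "x \<noteq> 0"
  shows "card (vec.span {x}) = CARD('a)"
  using card_span_independent[OF vec.vector_space_axioms, of "{x}"] assms by simp

lemma proj_point_iff:
  fixes P :: "('a::field ^ 'n) set"
  shows "proj_point P \<longleftrightarrow> (\<exists>v. v \<noteq> 0 \<and> P = vec.span {v})"
proof
  assume P: "proj_point P"
  then obtain B where B: "B \<subseteq> P" "vec.independent B" "P \<subseteq> vec.span B" "card B = 1"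
    using vec.basis_exists[of P] by (auto simp: proj_space_def)
  then obtain v where v: "B = {v}" by (meson card_1_singletonE)
  have "vec.span B = P" using B P vec.span_minimal[of B P] by (auto simp: proj_space_def)
  moreover have "v \<noteq> 0" using B(2) v by (metis vec.dependent_single)
  ultimately show "\<exists>v. v \<noteq> 0 \<and> P = vec.span {v}" using v by auto
next
  assume "\<exists>v. v \<noteq> 0 \<and> P = vec.span {v}"
  then obtain v where "v \<noteq> 0" "P = vec.span {v}" by blast
  then show "proj_point P"
    using vec.dim_span_eq_card_independent[of "{v}"]
    by (auto simp: proj_space_def)
qed

lemma dim_span_two:
  fixes x y :: "'a::field ^ 'n"
  assumes "x \<noteq> 0" "y \<notin> vec.span {x}"
  shows "proj_line (vec.span {x, y})"
proof -
  have "vec.independent {y, x}" 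
    using assms by (simp add: vec.independent_insert)
  moreover have "card {y, x} = 2" using assms by (metis card_2_iff insertI1 insert_commute vec.span_base)
  ultimately show ?thesis
    using vec.dim_span_eq_card_independent[of "{y, x}"] by (simp add: proj_space_def insert_commute)
qed

lemma proj_line_subspace: "proj_line L \<Longrightarrow> vec.subspace L"
  by (simp add: proj_space_def)

lemma proj_line_eq_span:
  fixes x y :: "'a::field ^ 'n"
  assumes "proj_line L" "x \<in> L" "y \<in> L" "x \<noteq> 0" "y \<notin> vec.span {x}"
  shows "L = vec.span {x, y}"
proof -
  have "vec.span {x, y} \<subseteq> L"
    using assms by (intro vec.span_minimal) (auto simp: proj_space_def)
  moreover have "vec.dim (vec.span {x, y}) = 2"
    using dim_span_two[OF assms(4,5)] by (simp add: proj_space_def)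
  ultimately show ?thesis
    using vec.subspace_dim_equal[of "vec.span {x, y}" L] assms(1) by (auto simp: proj_space_def)
qed

lemma card_proj_line:
  fixes L :: "('a::{field,finite} ^ 'n) set"
  assumes "proj_line L"
  shows "card L = CARD('a) ^ 2"
  using card_subspace[of L] assms by (simp add: proj_space_def power2_eq_square)

lemma proj_line_obtain:
  fixes x :: "'a::{field,finite} ^ 'n"
  assumes "proj_line L" "x \<in> L" "x \<noteq> 0"
  obtains y where "y \<in> L" "y \<notin> vec.span {x}" "y \<noteq> 0" "L = vec.span {x, y}"
proof -
  have "\<not> L \<subseteq> vec.span {x}"
  proof
    assume "L \<subseteq> vec.span {x}"
    then have "vec.dim L \<le> 1"
      using vec.dim_subset[of L "vec.span {x}"] proj_point_iff[of "vec.span {x}"] assms(3)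
      by (auto simp: proj_space_def)
    then show False using assms(1) by (simp add: proj_space_def)
  qed
  then obtain y where y: "y \<in> L" "y \<notin> vec.span {x}" by auto
  then have "y \<noteq> 0" using vec.span_zero by auto
  then show ?thesis using that y proj_line_eq_span[OF assms(1,2) y(1) assms(3) y(2)] by blast
qed

text \<open>Adding 1 permutes the field, so comparing the sum of all elements with the shifted sum
  gives \<open>of_nat (CARD('a)) = 0\<close>, that is \<open>2 ^ h = 0\<close>.\<close>

lemma finite_field_two_eq_zero:
  assumes "CARD('a::{field,finite}) = 2 ^ h"
  shows "(1::'a) + 1 = 0"
proof -
  have "(\<Sum>x\<in>(UNIV::'a set). x) = (\<Sum>x\<in>(UNIV::'a set). x + 1)"
    by (rule sum.reindex_bij_betw[symmetric, of "\<lambda>x. x + 1" UNIV UNIV id, simplified])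
       (rule bij_plus_right)
  then have "of_nat (CARD('a)) = (0::'a)" by (simp add: sum.distrib)
  then have "(2::'a) ^ h = 0" by (simp add: assms)
  then show ?thesis by simp
qed

text \<open>Every vector of \<open>W\<close> outside the point of \<open>y\<close> lies on exactly
  one line of \<open>W\<close> through that point, so the pencil partitions
  \<open>X\<close>.\<close>

lemma card_pencil_sum:
  fixes W :: "('a::{field,finite} ^ 'n) set"
  assumes W: "vec.subspace W" and y: "y \<in> W" "y \<noteq> 0" and X: "X \<subseteq> W - vec.span {y}"
  shows "card X = (\<Sum>M | proj_line M \<and> y \<in> M \<and> M \<subseteq> W. card (X \<inter> M))"
proof -
  let ?\<M> = "{M. proj_line M \<and> y \<in> M \<and> M \<subseteq> W}"
  have "X = (\<Union>M\<in>?\<M>. X \<inter> M)"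
  proof
    show "X \<subseteq> (\<Union>M\<in>?\<M>. X \<inter> M)"
    proof
      fix x assume x: "x \<in> X"
      then have "proj_line (vec.span {y, x})" using X y(2) by (intro dim_span_two) auto
      moreover have "vec.span {y, x} \<subseteq> W" using x X y W by (intro vec.span_minimal) auto
      moreover have "x \<in> vec.span {y, x}" "y \<in> vec.span {y, x}" by (auto intro: vec.span_base)
      ultimately show "x \<in> (\<Union>M\<in>?\<M>. X \<inter> M)" using x by blast
    qed
  qed auto
  also have "card \<dots> = (\<Sum>M\<in>?\<M>. card (X \<inter> M))"
  proof (rule card_UN_disjoint)
    show "\<forall>M\<in>?\<M>. \<forall>M'\<in>?\<M>. M \<noteq> M' \<longrightarrow> X \<inter> M \<inter> (X \<inter> M') = {}"
    proof (intro ballI impI, rule ccontr)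
      fix M M' assume M: "M \<in> ?\<M>" "M' \<in> ?\<M>" "M \<noteq> M'" "X \<inter> M \<inter> (X \<inter> M') \<noteq> {}"
      then obtain x where x: "x \<in> X" "x \<in> M" "x \<in> M'" by auto
      then have "x \<notin> vec.span {y}" using X by auto
      then have "M = vec.span {y, x}" "M' = vec.span {y, x}"
        using M x y(2) proj_line_eq_span by blast+
      then show False using M(3) by simp
    qed
  qed auto
  finally show ?thesis .
qed

section \<open>Sums of subspaces and of additive groups\<close>

text \<open>Minkowski sum, used for subspaces and equally for additive groups such as
  \<open>U \<inter> L\<close>.\<close>

definition ssum :: "'b::plus set \<Rightarrow> 'b set \<Rightarrow> 'b set" where
  "ssum X Y = {x + y | x y. x \<in> X \<and> y \<in> Y}"

lemma ssumI: "x \<in> X \<Longrightarrow> y \<in> Y \<Longrightarrow> x + y \<in> ssum X Y"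
  by (auto simp: ssum_def)

lemma ssumE:
  assumes "z \<in> ssum X Y"
  obtains x y where "x \<in> X" "y \<in> Y" "z = x + y"
  using assms by (auto simp: ssum_def)

lemma subset_ssumE:
  assumes "N \<subseteq> ssum X Y" "z \<in> N"
  obtains x y where "x \<in> X" "y \<in> Y" "z = x + y"
  using assms ssumE by (metis subsetD)

lemma ssum_commute: "ssum X Y = ssum Y (X :: 'b::ab_semigroup_add set)"
  by (auto simp: ssum_def) (metis add.commute)+

lemma subspace_ssum: "vec.subspace X \<Longrightarrow> vec.subspace Y \<Longrightarrow> vec.subspace (ssum X Y)"
  unfolding ssum_def by (rule vec.subspace_sums)

lemma dim_ssum:
  "vec.subspace X \<Longrightarrow> vec.subspace Y \<Longrightarrow>
    vec.dim (ssum X Y) + vec.dim (X \<inter> Y) = vec.dim X + vec.dim Y"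
  unfolding ssum_def by (rule vec.dim_sums_Int)

lemma direct_sum_unique:
  fixes x y x' y' :: "'a::field ^ 'n"
  assumes "vec.subspace X" "vec.subspace Y" "X \<inter> Y = {0}"
    and "x \<in> X" "x' \<in> X" "y \<in> Y" "y' \<in> Y" "x + y = x' + y'"
  shows "x = x' \<and> y = y'"
proof -
  have "x - x' = y' - y" using assms(8) by (simp add: algebra_simps)
  moreover have "x - x' \<in> X" "y' - y \<in> Y" using assms by (auto intro: vec.subspace_diff)
  ultimately have "x - x' \<in> X \<inter> Y" by simp
  then have "x - x' = 0" using assms(3) by auto
  then show ?thesis using assms(8) by simp
qed

lemma card_ssum:
  fixes X Y :: "('a::{field,finite} ^ 'n) set"
  assumes inj: "\<And>x x' y y'. x \<in> X \<Longrightarrow> x' \<in> X \<Longrightarrow> y \<in> Y \<Longrightarrow> y' \<in> Y \<Longrightarrow> x + y = x' + y' \<Longrightarrow> x = x' \<and> y = y'"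
  shows "card (ssum X Y) = card X * card Y"
proof -
  have "ssum X Y = (\<lambda>(x, y). x + y) ` (X \<times> Y)" by (auto simp: ssum_def)
  moreover have "inj_on (\<lambda>(x, y). x + y) (X \<times> Y)" using inj by (auto simp: inj_on_def)
  ultimately show ?thesis by (simp add: card_image card_cartesian_product)
qed

lemma points_of_Int_eq_empty_iff:
  fixes T L :: "('a::field ^ 'n) set"
  assumes "vec.subspace T" "vec.subspace L"
  shows "points_of T \<inter> points_of L = {} \<longleftrightarrow> T \<inter> L = {0}"
proof
  assume *: "points_of T \<inter> points_of L = {}"
  show "T \<inter> L = {0}"
  proof (rule ccontr)
    assume "T \<inter> L \<noteq> {0}"
    then obtain x where x: "x \<in> T" "x \<in> L" "x \<noteq> 0" using vec.subspace_0 assms by blast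
    then have "vec.span {x} \<in> points_of T \<inter> points_of L"
      using assms by (auto simp: points_of_def proj_point_iff span_singleton_subset_iff)
    then show False using * by simp
  qed
next
  assume *: "T \<inter> L = {0}"
  show "points_of T \<inter> points_of L = {}"
  proof (rule ccontr)
    assume "points_of T \<inter> points_of L \<noteq> {}"
    then obtain x where "x \<noteq> 0" "vec.span {x} \<subseteq> T" "vec.span {x} \<subseteq> L"
      by (auto simp: points_of_def proj_point_iff)
    then show False using * vec.span_base[of x "{x}"] by blast
  qed
qed

section \<open>Affine points and directions in coordinates\<close>

lemma span_affine_in:
  fixes H :: "('a::{field,finite} ^ 'n) set"
  assumes H: "vec.subspace H" and dim: "vec.dim H + 1 = CARD('n)" and e: "e \<notin> H"
  obtains c where "p - c *s e \<in> H"
proof -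
  have spH: "vec.span H = H" using H by (simp add: vec.span_eq_iff)
  have "vec.dim (insert e H) = CARD('n)" using e dim by (simp add: vec.dim_insert spH)
  then have "vec.dim (vec.span (insert e H)) = vec.dim (UNIV :: ('a ^ 'n) set)"
    by (simp only: vec.dim_span vec_dim_card)
  then have "vec.span (insert e H) = UNIV" by (intro vec.subspace_dim_equal) auto
  then have "p \<in> vec.span (insert e H)" by simp
  then show ?thesis using that unfolding vec.span_breakdown_eq spH by blast
qed

text \<open>For \<open>a *s (e + v) + b *s (e + w)\<close> to lie in \<open>H\<close> the
  coefficient of \<open>e\<close> must vanish, which leaves \<open>a *s (v - w)\<close>.\<close>

lemma direction_affine:
  fixes H :: "('a::field ^ 'n) set"
  assumes H: "vec.subspace H" and e: "e \<notin> H" and v: "v \<in> H" and w: "w \<in> H"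
  shows "direction H (vec.span {e + v}) (vec.span {e + w}) = vec.span {v - w}"
proof -
  have eH: "c = 0" if "c *s e \<in> H" for c
  proof (rule ccontr)
    assume "c \<noteq> 0"
    then have "inverse c *s (c *s e) = e" by simp
    then show False using e vec.subspace_scale[OF H that, of "inverse c"] by simp
  qed
  have "vec.span (vec.span {e + v} \<union> vec.span {e + w}) \<inter> H = vec.span {v - w}"
  proof
    show "vec.span (vec.span {e + v} \<union> vec.span {e + w}) \<inter> H \<subseteq> vec.span {v - w}"
    proof
      fix x assume x: "x \<in> vec.span (vec.span {e + v} \<union> vec.span {e + w}) \<inter> H"
      then have "x \<in> {y + z | y z. y \<in> vec.span (vec.span {e + v}) \<and> z \<in> vec.span (vec.span {e + w})}"
        by (simp only: vec.span_Un Int_iff)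
      then obtain a b where ab: "x = a *s (e + v) + b *s (e + w)"
        by (auto simp: in_span_singleton vec.span_span)
      have "(a + b) *s e = x - (a *s v + b *s w)"
        by (simp add: ab vec.scale_right_distrib vec.scale_left_distrib)
      also have "\<dots> \<in> H"
        using x v w by (intro vec.subspace_diff[OF H] vec.subspace_add[OF H] vec.subspace_scale[OF H]) auto
      finally have "b = - a" using eH by (simp add: eq_neg_iff_add_eq_0 add.commute)
      then have "x = a *s (v - w)"
        by (simp add: ab vec.scale_right_distrib vec.scale_right_diff_distrib)
      then show "x \<in> vec.span {v - w}" by (auto simp: in_span_singleton)
    qed
    have "(e + v) - (e + w) \<in> vec.span (vec.span {e + v} \<union> vec.span {e + w})"
      by (intro vec.span_diff) (auto intro: vec.span_base)
    then have "v - w \<in> vec.span (vec.span {e + v} \<union> vec.span {e + w})" by simp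
    moreover have "v - w \<in> H" using v w by (rule vec.subspace_diff[OF H])
    ultimately show "vec.span {v - w} \<subseteq> vec.span (vec.span {e + v} \<union> vec.span {e + w}) \<inter> H"
      using H by (simp add: span_singleton_subset_iff)
  qed
  then show ?thesis by (simp add: direction_def)
qed

lemma card_bit: "CARD(bit) = 2"
proof -
  have "(UNIV :: bit set) = {0, 1}" by (auto simp: bit_not_one_iff)
  then have "CARD(bit) = card {0 :: bit, 1}" by (simp only:)
  then show ?thesis by simp
qed

section \<open>Sets with few directions\<close>

text \<open>Common ground of the set \<open>A\<close> and of its translate \<open>U\<close>, which
  takes the place of \<open>A\<close> in \<open>scattered_group\<close>.\<close>

locale char_two_set =
  fixes A :: "('a::{field,finite} ^ 'n) set" and q k :: nat
  assumes char2: "(1::'a) + 1 = 0"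
    and card_field [simp]: "CARD('a) = q"
    and q_ge: "q \<ge> 16"
    and k_ge: "k \<ge> 2"
    and card_A: "card A = q ^ k"
begin

lemma vadd_self [simp]: "x + x = (0 :: 'a ^ 'n)"
proof -
  have "x + x = (1 + 1) *s x" by (simp only: vec.scale_left_distrib vec.scale_one)
  then show ?thesis by (simp only: char2 vec.scale_zero_left)
qed

lemma vminus_eq: "- x = (x :: 'a ^ 'n)"
  using vadd_self[of x] by (simp add: minus_unique del: vadd_self)

lemma vdiff_eq: "x - y = x + (y :: 'a ^ 'n)"
  by (metis vminus_eq diff_conv_add_uminus)

end

locale direction_set = char_two_set A q k
  for A :: "('a::{field,finite} ^ 'n) set" and q k +
  fixes D :: "('a ^ 'n) set set"
  assumes D_eq: "D = {vec.span {a - b} | a b. a \<in> A \<and> b \<in> A \<and> a \<noteq> b}"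
    and card_D: "card D = q ^ k - 1"
    and line_D: "\<And>L. proj_line L \<Longrightarrow> card {P \<in> D. P \<subseteq> L} \<in> {0, 1, 3, q - 1}"
begin

section \<open>Degrees of lines and exclusion of three collinear points\<close>

definition deg :: "('a ^ 'n) set \<Rightarrow> nat" where "deg W = card {P \<in> D. P \<subseteq> W}"

lemma deg_cases: "proj_line L \<Longrightarrow> deg L \<in> {0, 1, 3, q - 1}"
  using line_D unfolding deg_def .

lemma span_diff_in_D: "a \<in> A \<Longrightarrow> b \<in> A \<Longrightarrow> a \<noteq> b \<Longrightarrow> vec.span {a - b} \<in> D"
  by (auto simp: D_eq)

lemma D_point: "P \<in> D \<Longrightarrow> \<exists>v. v \<noteq> 0 \<and> P = vec.span {v}"
  by (force simp: D_eq)

lemma span_diff_commute: "vec.span {x - y} = vec.span {y - x :: 'a ^ 'n}"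
  by (metis minus_diff_eq vminus_eq)

text \<open>The lines through a point outside \<open>D\<close> contain at most one point of \<open>A\<close> each.\<close>

lemma card_plane_le:
  assumes L: "proj_line L" and v: "v \<in> L" "v \<noteq> 0" "vec.span {v} \<notin> D"
  shows "card {x \<in> A. x - a \<in> L} \<le> q"
proof -
  obtain r where r: "r \<in> L" "L = vec.span {v, r}" using proj_line_obtain[OF L v(1,2)] by metis
  have "\<forall>x\<in>L. \<exists>t. x - t *s r \<in> vec.span {v}"
    using r(2) vec.span_breakdown_eq[of _ r "{v}"] by (metis insert_commute)
  \<comment> \<open>\<open>t\<close> is the coordinate along \<open>r\<close> modulo
    \<open>v\<close>; equal values at two points of \<open>A\<close> would make \<open>v\<close> a
    direction.\<close>
  then obtain t where t: "\<And>x. x \<in> L \<Longrightarrow> x - t x *s r \<in> vec.span {v}" by metis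
  have "inj_on (\<lambda>x. t (x - a)) {x \<in> A. x - a \<in> L}"
  proof (rule inj_onI, rule ccontr)
    fix x y assume x: "x \<in> {x \<in> A. x - a \<in> L}" and y: "y \<in> {x \<in> A. x - a \<in> L}"
      and eq: "t (x - a) = t (y - a)" and ne: "x \<noteq> y"
    have "(x - a - t (x - a) *s r) - (y - a - t (y - a) *s r) \<in> vec.span {v}"
      using vec.span_diff[OF t[of "x - a"] t[of "y - a"]] x y by blast
    then have "x - y \<in> vec.span {v}" by (simp add: eq)
    then have "vec.span {x - y} = vec.span {v}" using ne by (intro span_singleton_eq) auto
    then show False using span_diff_in_D[of x y] x y ne v(3) by simp
  qed
  from card_inj_on_le[OF this, of UNIV] show ?thesis by simp
qed

text \<open>A line carries \<open>q ^ 2 - 1\<close> nonzero vectors, and at most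
  \<open>q - 1\<close> directions account for only \<open>(q - 1) * (q - 1)\<close> of them.\<close>

lemma ex_nondirection:
  assumes L: "proj_line L" 
  obtains v where "v \<in> L" "v \<noteq> 0" "vec.span {v} \<notin> D"
proof (rule ccontr)
  assume "\<not> thesis"
  then have all: "\<And>v. v \<in> L \<Longrightarrow> v \<noteq> 0 \<Longrightarrow> vec.span {v} \<in> D" using that by blast
  let ?S = "{P \<in> D. P \<subseteq> L}"
  have sub: "vec.subspace L" using L by (rule proj_line_subspace)
  have "L - {0} \<subseteq> (\<Union>P\<in>?S. P - {0})"
  proof
    fix v assume v: "v \<in> L - {0}"
    then have "vec.span {v} \<in> ?S" using all span_singleton_subset_iff[OF sub] by simp
    moreover have "v \<in> vec.span {v} - {0}" using v by (simp add: vec.span_base)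
    ultimately show "v \<in> (\<Union>P\<in>?S. P - {0})" by blast
  qed
  then have "card (L - {0}) \<le> card (\<Union>P\<in>?S. P - {0})" by (intro card_mono) auto
  also have "\<dots> \<le> (\<Sum>P\<in>?S. card (P - {0}))" by (rule card_UN_le) simp
  also have "\<dots> = (\<Sum>P\<in>?S. q - 1)"
  proof (rule sum.cong)
    fix P assume "P \<in> ?S"
    then obtain v where v: "v \<noteq> 0" "P = vec.span {v}" using D_point by blast
    then show "card (P - {0}) = q - 1"
      using card_span_singleton[OF v(1)] by (subst card_Diff_singleton) (simp_all add: vec.span_zero)
  qed simp
  also have "\<dots> \<le> (q - 1) * (q - 1)"
  proof -
    have "deg L \<le> q - 1" using deg_cases[OF L] q_ge by auto
    then show ?thesis by (simp add: deg_def)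
  qed
  finally have "q ^ 2 - 1 \<le> (q - 1) * (q - 1)"
    using card_proj_line[OF L] vec.subspace_0[OF sub] by simp
  moreover have "(q - 1) * (q - 1) + 2 * q = q ^ 2 + 1"
    using q_ge by (cases q) (auto simp: power2_eq_square algebra_simps)
  ultimately show False using q_ge by linarith
qed

lemma q_lt_card_A: "q < card A"
proof -
  have "q ^ 1 < q ^ k" using q_ge k_ge by (intro power_strict_increasing) auto
  then show ?thesis by (simp add: card_A)
qed

text \<open>Arithmetic for \<open>no_three_collinear\<close>: \<open>N\<close> points in total,
  \<open>m\<close> on the bad line, \<open>c\<close> planes through it with further points.
  Eliminating \<open>c\<close> gives \<open>(m - 2) * (N - q) \<le> 0\<close>.\<close>

lemma line_card_bound:
  fixes N c m :: nat
  assumes "N - m \<le> c * (q - m)" "c * (q - 2) \<le> N - 2" "m \<ge> 3" "m \<le> q" "q < N"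
  shows False
proof -
  have "int (N - m) \<le> int (c * (q - m))" "int (c * (q - 2)) \<le> int (N - 2)"
    using assms(1,2) by (simp_all only: of_nat_le_iff)
  then have 1: "int N - int m \<le> int c * (int q - int m)"
    and 2: "int c * (int q - 2) \<le> int N - 2"
    using assms(3-5) by (simp_all add: of_nat_diff)
  have "(int q - 2) * (int N - int m) \<le> (int q - 2) * (int c * (int q - int m))"
    using 1 assms by (intro mult_left_mono) auto
  also have "\<dots> = int c * (int q - 2) * (int q - int m)" by (simp add: algebra_simps)
  also have "\<dots> \<le> (int N - 2) * (int q - int m)"
    using 2 assms by (intro mult_right_mono) auto
  finally have "(int m - 2) * (int N - int q) \<le> 0" by (simp add: algebra_simps)
  moreover have "(int m - 2) * (int N - int q) > 0" using assms by simp
  ultimately show False by simp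
qed

text \<open>Given a line with three points of \<open>A\<close>, every plane through it with a
  further point of \<open>A\<close> has at least 4 directions, hence \<open>q - 1\<close>. Such a
  plane holds at most \<open>q\<close> points of \<open>A\<close>, so many planes occur; but each
  brings \<open>q - 2\<close> directions of its own, and \<open>D\<close> is too small for
  that.\<close>

lemma no_three_collinear:
  assumes A: "a \<in> A" "b \<in> A" "c \<in> A" "a \<noteq> b" "c - a \<in> vec.span {b - a}"
  shows "c = a \<or> c = b"
proof (rule ccontr)
  assume nc: "\<not> (c = a \<or> c = b)"
  define d where "d = b - a"
  \<comment> \<open>\<open>M\<close> collects the points of \<open>A\<close> on the line, and
    \<open>F x\<close> is the line at infinity of the plane through that line and
    \<open>x\<close>.\<close>
  define M where "M = {x \<in> A. x - a \<in> vec.span {d}}"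
  define F where "F x = vec.span {d, x - a}" for x
  have d0: "d \<noteq> 0" using A by (simp add: d_def)
  have "{a, b, c} \<subseteq> M" using A by (auto simp: M_def d_def vec.span_zero vec.span_base)
  then have "card {a, b, c} \<le> card M" by (intro card_mono) (auto simp: M_def)
  then have m3: "card M \<ge> 3" using A nc by auto
  have Mdiff: "y - z \<in> vec.span {d}" if "y \<in> M" "z \<in> M" for y z
    using that vec.span_diff[of "y - a" "{d}" "z - a"] by (simp add: M_def)
  have Fline: "proj_line (F x)" if "x \<in> A - M" for x
    unfolding F_def using that d0 by (intro dim_span_two) (auto simp: M_def)
  have Fdeg: "deg (F x) = q - 1" if x: "x \<in> A - M" for x
  proof -
    \<comment> \<open>The directions from \<open>x\<close> to the points of \<open>M\<close>;
      together with the direction of \<open>d\<close> they are at least 4.\<close>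
    let ?g = "\<lambda>y. vec.span {x - y}"
    have xM: "x - y \<notin> vec.span {d}" if "y \<in> M" for y
    proof
      assume "x - y \<in> vec.span {d}"
      then have "(x - y) + (y - a) \<in> vec.span {d}"
        using that by (intro vec.span_add) (auto simp: M_def)
      then show False using x by (simp add: M_def)
    qed
    have inj: "inj_on ?g M"
    proof (rule inj_onI, rule ccontr)
      fix y z assume y: "y \<in> M" and z: "z \<in> M" and eq: "?g y = ?g z" and ne: "y \<noteq> z"
      have "x - z \<in> ?g y" by (simp add: eq vec.span_base)
      moreover have "x - y \<in> ?g y" by (simp add: vec.span_base)
      ultimately have "(x - z) - (x - y) \<in> ?g y" by (rule vec.span_diff)
      then have "y - z \<in> ?g y" by (simp add: algebra_simps)
      then have "?g y = vec.span {y - z}" using ne by (intro span_singleton_eq[symmetric]) auto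
      also have "\<dots> = vec.span {d}" using Mdiff[OF y z] ne by (intro span_singleton_eq) auto
      finally show False using xM[OF y] by (auto simp: vec.span_base)
    qed
    have nin: "vec.span {d} \<notin> ?g ` M"
      using xM vec.span_base by fastforce
    have "insert (vec.span {d}) (?g ` M) \<subseteq> {P \<in> D. P \<subseteq> F x}"
    proof -
      have "vec.span {d} \<in> D" using span_diff_in_D[of b a] A by (auto simp: d_def)
      moreover have "vec.span {d} \<subseteq> F x" unfolding F_def by (intro vec.span_mono) auto
      moreover have "?g y \<in> D \<and> ?g y \<subseteq> F x" if "y \<in> M" for y
      proof
        show "?g y \<in> D" using that x by (intro span_diff_in_D) (auto simp: M_def)
        have "(x - a) - (y - a) \<in> F x"
        proof (rule vec.subspace_diff)
          show "vec.subspace (F x)" by (simp add: F_def)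
          show "x - a \<in> F x" by (simp add: F_def vec.span_base)
          show "y - a \<in> F x" using that \<open>vec.span {d} \<subseteq> F x\<close> by (auto simp: M_def)
        qed
        then show "?g y \<subseteq> F x"
          using span_singleton_subset_iff[of "F x" "x - y"] by (simp add: F_def)
      qed
      ultimately show ?thesis by blast
    qed
    then have "card (insert (vec.span {d}) (?g ` M)) \<le> deg (F x)"
      unfolding deg_def by (intro card_mono) auto
    then have "deg (F x) \<ge> 4"
      using m3 nin card_image[OF inj] by (simp add: M_def)
    then show ?thesis using deg_cases[OF Fline[OF x]] by auto
  qed
  have plane: "card {x \<in> A. x - a \<in> F x0} \<le> q" if "x0 \<in> A - M" for x0
    by (rule ex_nondirection[OF Fline[OF that]]) (rule card_plane_le[OF Fline[OF that]])
  have Msub: "M \<subseteq> {x \<in> A. x - a \<in> F x0}" for x0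
    using vec.span_mono[of "{d}" "{d, x0 - a}"] by (auto simp: M_def F_def)
  have "card M \<le> q"
  proof -
    have "inj_on (\<lambda>x. x - a) M" by (auto simp: inj_on_def)
    moreover have "(\<lambda>x. x - a) ` M \<subseteq> vec.span {d}" by (auto simp: M_def)
    ultimately have "card M \<le> card (vec.span {d})" by (intro card_inj_on_le) auto
    then show ?thesis using card_span_singleton[OF d0] by simp
  qed
  define \<L> where "\<L> = F ` (A - M)"
  \<comment> \<open>All of \<open>M\<close> lies in each plane, so a plane holds at most
    \<open>q - card M\<close> points of \<open>A\<close> outside it.\<close>
  have "card (A - M) \<le> card \<L> * (q - card M)"
    unfolding \<L>_def
  proof (rule card_le_fibres)
    fix L assume "L \<in> F ` (A - M)"
    then obtain x0 where x0: "x0 \<in> A - M" "L = F x0" by auto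
    have "{x \<in> A - M. F x = L} \<union> M \<subseteq> {x \<in> A. x - a \<in> F x0}"
      using Msub[of x0] x0 by (auto simp: F_def intro: vec.span_base)
    then have "card ({x \<in> A - M. F x = L} \<union> M) \<le> q"
      using plane[OF x0(1)] card_mono[of "{x \<in> A. x - a \<in> F x0}"] by (meson finite le_trans)
    moreover have "card ({x \<in> A - M. F x = L} \<union> M) = card {x \<in> A - M. F x = L} + card M"
      by (intro card_Un_disjoint) auto
    ultimately show "card {x \<in> A - M. F x = L} \<le> q - card M" by linarith
  qed simp
  moreover have "card (A - M) = card A - card M"
    by (intro card_Diff_subset) (auto simp: M_def)
  \<comment> \<open>Two of these lines at infinity share only the point of \<open>d\<close>; without
    it their sets of directions are disjoint.\<close>
  moreover have "card \<L> * (q - 2) \<le> card D - 1"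
  proof -
    let ?G = "\<lambda>L. {P \<in> D. P \<subseteq> L} - {vec.span {d}}"
    have dD: "vec.span {d} \<in> D" using span_diff_in_D[of b a] A by (auto simp: d_def)
    have "card (\<Union>L\<in>\<L>. ?G L) = (\<Sum>L\<in>\<L>. card (?G L))"
    proof (rule card_UN_disjoint)
      show "\<forall>L\<in>\<L>. \<forall>L'\<in>\<L>. L \<noteq> L' \<longrightarrow> ?G L \<inter> ?G L' = {}"
      proof (intro ballI impI, rule ccontr)
        fix L L' assume L: "L \<in> \<L>" "L' \<in> \<L>" "L \<noteq> L'" "?G L \<inter> ?G L' \<noteq> {}"
        then obtain P where P: "P \<in> D" "P \<subseteq> L" "P \<subseteq> L'" "P \<noteq> vec.span {d}" by auto
        obtain v where v: "v \<noteq> 0" "P = vec.span {v}" using D_point[OF P(1)] by auto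
        have vd: "v \<notin> vec.span {d}" using span_singleton_eq[of v d] v P(4) by auto
        have vL: "v \<in> L" "v \<in> L'" using v P vec.span_base by auto
        have "d \<in> F x" for x by (simp add: F_def vec.span_base)
        then have "d \<in> L" "d \<in> L'" using L by (auto simp: \<L>_def)
        moreover have "proj_line L" "proj_line L'" using L Fline by (auto simp: \<L>_def)
        ultimately have "L = vec.span {d, v}" "L' = vec.span {d, v}"
          using d0 vd vL proj_line_eq_span by blast+
        then show False using L(3) by simp
      qed
    qed auto
    also have "\<dots> = (\<Sum>L\<in>\<L>. q - 2)"
    proof (rule sum.cong)
      fix L assume "L \<in> \<L>"
      then obtain x where x: "x \<in> A - M" "L = F x" by (auto simp: \<L>_def)
      have "vec.span {d} \<in> {P \<in> D. P \<subseteq> L}"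
        using dD vec.span_mono[of "{d}" "{d, x - a}"] x by (auto simp: F_def)
      then have "card (?G L) = deg L - 1" by (simp add: deg_def)
      then show "card (?G L) = q - 2" using Fdeg[OF x(1)] x(2) by simp
    qed simp
    finally have "card \<L> * (q - 2) = card (\<Union>L\<in>\<L>. ?G L)" by simp
    also have "\<dots> \<le> card (D - {vec.span {d}})" by (intro card_mono) auto
    also have "\<dots> = card D - 1" using dD by simp
    finally show ?thesis .
  qed
  ultimately show False
    using line_card_bound[of "card A" "card M" "card \<L>"] m3 \<open>card M \<le> q\<close> q_lt_card_A card_A card_D
    by linarith
qed

section \<open>Directions seen from one point of the set\<close>

text \<open>By \<open>no_three_collinear\<close> the \<open>q ^ k - 1\<close> other points lie in
  distinct directions from \<open>a\<close>, and \<open>D\<close> has just that many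
  elements.\<close>

lemma partner_exists:
  assumes a: "a \<in> A" and P: "P \<in> D"
  obtains b where "b \<in> A" "b \<noteq> a" "P = vec.span {b - a}"
proof -
  let ?g = "\<lambda>b. vec.span {b - a}"
  have inj: "inj_on ?g (A - {a})"
  proof (rule inj_onI)
    fix b c assume b: "b \<in> A - {a}" and c: "c \<in> A - {a}" and eq: "?g b = ?g c"
    have "c - a \<in> ?g b" by (simp add: eq vec.span_base)
    then show "b = c" using no_three_collinear[of a b c] a b c by auto
  qed
  have sub: "?g ` (A - {a}) \<subseteq> D" using a by (auto intro: span_diff_in_D)
  have "card (?g ` (A - {a})) = card D"
    using card_image[OF inj] a by (simp add: card_A card_D)
  then have "?g ` (A - {a}) = D" using sub by (intro card_subset_eq) auto
  then show ?thesis using P that by blast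
qed

text \<open>The bijection between \<open>A - {a}\<close> and \<open>D\<close> restricts to
  \<open>W\<close>; the extra 1 counts \<open>a\<close> itself.\<close>

lemma card_coset:
  assumes a: "a \<in> A" and W: "vec.subspace W"
  shows "card {x \<in> A. x - a \<in> W} = deg W + 1"
proof -
  let ?g = "\<lambda>b. vec.span {b - a}"
  let ?X = "{x \<in> A. x - a \<in> W}"
  have "bij_betw ?g (?X - {a}) {P \<in> D. P \<subseteq> W}"
  proof (rule bij_betw_imageI)
    show "inj_on ?g (?X - {a})"
    proof (rule inj_onI)
      fix b c assume b: "b \<in> ?X - {a}" and c: "c \<in> ?X - {a}" and eq: "?g b = ?g c"
      have "c - a \<in> ?g b" by (simp add: eq vec.span_base)
      then show "b = c" using no_three_collinear[of a b c] a b c by auto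
    qed
    show "?g ` (?X - {a}) = {P \<in> D. P \<subseteq> W}"
    proof
      show "?g ` (?X - {a}) \<subseteq> {P \<in> D. P \<subseteq> W}"
        using a span_singleton_subset_iff[OF W] by (auto intro: span_diff_in_D)
      show "{P \<in> D. P \<subseteq> W} \<subseteq> ?g ` (?X - {a})"
      proof
        fix P assume "P \<in> {P \<in> D. P \<subseteq> W}"
        moreover then obtain b where b: "b \<in> A" "b \<noteq> a" "P = ?g b" using partner_exists[OF a] by blast
        ultimately show "P \<in> ?g ` (?X - {a})" using span_singleton_subset_iff[OF W] by auto
      qed
    qed
  qed
  then have "card (?X - {a}) = deg W" unfolding deg_def by (rule bij_betw_same_card)
  moreover have "a \<in> ?X" using a vec.subspace_0[OF W] by simp
  then have "card ?X = Suc (card (?X - {a}))" by (intro card.remove) auto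
  ultimately show ?thesis by simp
qed

lemma A_nonempty: obtains a where "a \<in> A"
  using q_lt_card_A by fastforce

lemma deg_ge_3:
  assumes L: "proj_line L" and P: "P \<in> D" "P' \<in> D" "P \<noteq> P'" "P \<subseteq> L" "P' \<subseteq> L"
  shows "deg L = 3 \<or> deg L = q - 1"
proof -
  have "card {P, P'} \<le> deg L" unfolding deg_def using P by (intro card_mono) auto
  then have "deg L \<ge> 2" using P(3) by simp
  then show ?thesis using deg_cases[OF L] by auto
qed

section \<open>Disjointness of long secants\<close>

text \<open>Passes from points to vectors, which are what \<open>card_pencil_sum\<close>
  counts.\<close>

lemma card_direction_vectors:
  assumes M: "vec.subspace M"
  shows "card {v \<in> M. v \<noteq> 0 \<and> vec.span {v} \<in> D} = (q - 1) * deg M"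
proof -
  let ?S = "{P \<in> D. P \<subseteq> M}"
  have "{v \<in> M. v \<noteq> 0 \<and> vec.span {v} \<in> D} = (\<Union>P\<in>?S. P - {0})"
  proof
    show "{v \<in> M. v \<noteq> 0 \<and> vec.span {v} \<in> D} \<subseteq> (\<Union>P\<in>?S. P - {0})"
    proof
      fix v assume v: "v \<in> {v \<in> M. v \<noteq> 0 \<and> vec.span {v} \<in> D}"
      then have "vec.span {v} \<in> ?S" using span_singleton_subset_iff[OF M] by simp
      moreover have "v \<in> vec.span {v} - {0}" using v by (simp add: vec.span_base)
      ultimately show "v \<in> (\<Union>P\<in>?S. P - {0})" by blast
    qed
    show "(\<Union>P\<in>?S. P - {0}) \<subseteq> {v \<in> M. v \<noteq> 0 \<and> vec.span {v} \<in> D}"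
    proof
      fix v assume "v \<in> (\<Union>P\<in>?S. P - {0})"
      then obtain P where P: "P \<in> D" "P \<subseteq> M" "v \<in> P" "v \<noteq> 0" by auto
      obtain w where "P = vec.span {w}" using D_point[OF P(1)] by auto
      then have "vec.span {v} = P" using span_singleton_eq[of v w] P by simp
      then show "v \<in> {v \<in> M. v \<noteq> 0 \<and> vec.span {v} \<in> D}" using P by auto
    qed
  qed
  also have "card \<dots> = (\<Sum>P\<in>?S. card (P - {0}))"
  proof (rule card_UN_disjoint)
    show "\<forall>P\<in>?S. \<forall>P'\<in>?S. P \<noteq> P' \<longrightarrow> (P - {0}) \<inter> (P' - {0}) = {}"
    proof (intro ballI impI, rule ccontr)
      fix P P' assume P: "P \<in> ?S" "P' \<in> ?S" "P \<noteq> P'" "(P - {0}) \<inter> (P' - {0}) \<noteq> {}"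
      then obtain v where v: "v \<in> P" "v \<in> P'" "v \<noteq> 0" by auto
      obtain w w' where "P = vec.span {w}" "P' = vec.span {w'}"
        using D_point[of P] D_point[of P'] P by auto
      then have "P = vec.span {v}" "P' = vec.span {v}" using span_singleton_eq v by metis+
      then show False using P(3) by simp
    qed
  qed auto
  also have "\<dots> = (\<Sum>P\<in>?S. q - 1)"
  proof (rule sum.cong)
    fix P assume "P \<in> ?S"
    then obtain v where v: "v \<noteq> 0" "P = vec.span {v}" using D_point by blast
    then show "card (P - {0}) = q - 1"
      using card_span_singleton[OF v(1)] by (subst card_Diff_singleton) (simp_all add: vec.span_zero)
  qed simp
  finally show ?thesis by (simp add: deg_def)
qed

text \<open>A coset of \<open>W\<close> splits into \<open>q\<close> cosets of \<open>M\<close>,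
  indexed by the coordinate along a vector outside \<open>M\<close>; by \<open>card_coset\<close>
  each holds \<open>deg M + 1\<close> points of \<open>A\<close> or none.\<close>

lemma card_solid_le:
  assumes W: "proj_space 2 W" and M: "proj_line M" "M \<subseteq> W"
  shows "card {x \<in> A. x - a \<in> W} \<le> q * (deg M + 1)"
proof -
  have sW: "vec.subspace W" "vec.dim W = 3" and sM: "vec.subspace M" "vec.dim M = 2"
    using W M by (simp_all add: proj_space_def)
  have "W \<noteq> M" using sW sM by auto
  then obtain r where r: "r \<in> W" "r \<notin> M" using M(2) by blast
  have spM: "vec.span M = M" using sM(1) by (simp add: vec.span_eq_iff)
  have "vec.dim (insert r M) = 3" using r(2) sM(2) by (simp add: vec.dim_insert spM)
  then have "vec.dim (vec.span (insert r M)) = 3" by simp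
  moreover have "vec.span (insert r M) \<subseteq> W" using r M sW by (intro vec.span_minimal) auto
  ultimately have W_eq: "vec.span (insert r M) = W"
    using sW by (intro vec.subspace_dim_equal) auto
  have "\<forall>x\<in>W. \<exists>t. x - t *s r \<in> M"
    using vec.span_breakdown_eq[of _ r M] W_eq spM by simp
  then obtain t where t: "\<And>x. x \<in> W \<Longrightarrow> x - t x *s r \<in> M" by metis
  let ?X = "{x \<in> A. x - a \<in> W}" and ?f = "\<lambda>x. t (x - a)"
  have "card ?X \<le> card (?f ` ?X) * (deg M + 1)"
  proof (rule card_le_fibres)
    fix s assume "s \<in> ?f ` ?X"
    then obtain x0 where x0: "x0 \<in> ?X" "s = ?f x0" by auto
    have "{x \<in> ?X. ?f x = s} \<subseteq> {x \<in> A. x - x0 \<in> M}"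
    proof
      fix x assume x: "x \<in> {x \<in> ?X. ?f x = s}"
      have "(x - a - t (x - a) *s r) - (x0 - a - t (x0 - a) *s r) \<in> M"
        using vec.subspace_diff[OF sM(1) t[of "x - a"] t[of "x0 - a"]] x x0 by blast
      then show "x \<in> {x \<in> A. x - x0 \<in> M}" using x x0 by simp
    qed
    then have "card {x \<in> ?X. ?f x = s} \<le> card {x \<in> A. x - x0 \<in> M}" by (intro card_mono) auto
    then show "card {x \<in> ?X. ?f x = s} \<le> deg M + 1"
      using card_coset[of x0 M] x0 sM by simp
  qed simp
  also have "\<dots> \<le> q * (deg M + 1)"
    using card_mono[of "UNIV :: 'a set" "?f ` ?X"] by (intro mult_right_mono) auto
  finally show ?thesis .
qed

text \<open>
  If two long secants met, the plane \<open>W\<close> at infinity would carry at least \<open>q\<^sup>2 / 2\<close> points of \<open>A\<close> in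
  a coset, whereas a line with at most 3 directions allows only \<open>4 q\<close>. So all lines of \<open>W\<close> are
  long, and counting along the pencils of a direction and of a nondirection gives different totals.
\<close>

lemma long_secants_disjoint:
  assumes L1: "proj_line L1" "deg L1 = q - 1" and L2: "proj_line L2" "deg L2 = q - 1"
    and ne: "L1 \<noteq> L2"
  shows "L1 \<inter> L2 = {0}"
proof (rule ccontr)
  assume "L1 \<inter> L2 \<noteq> {0}"
  have s: "vec.subspace L1" "vec.subspace L2" using L1 L2 by (auto intro: proj_line_subspace)
  then obtain x where x: "x \<in> L1" "x \<in> L2" "x \<noteq> 0"
    using \<open>L1 \<inter> L2 \<noteq> {0}\<close> vec.subspace_0 by blast
  have int: "L1 \<inter> L2 = vec.span {x}"
  proof
    show "vec.span {x} \<subseteq> L1 \<inter> L2" using x s by (simp add: span_singleton_subset_iff)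
    show "L1 \<inter> L2 \<subseteq> vec.span {x}"
    proof (rule ccontr)
      assume "\<not> L1 \<inter> L2 \<subseteq> vec.span {x}"
      then obtain y where "y \<in> L1" "y \<in> L2" "y \<notin> vec.span {x}" by auto
      then show False using x ne proj_line_eq_span[OF L1(1)] proj_line_eq_span[OF L2(1)] by metis
    qed
  qed
  define W where "W = {u + v | u v. u \<in> L1 \<and> v \<in> L2}"
  have sW: "vec.subspace W" unfolding W_def by (rule vec.subspace_sums[OF s])
  have "vec.dim W + vec.dim (L1 \<inter> L2) = vec.dim L1 + vec.dim L2"
    unfolding W_def by (rule vec.dim_sums_Int[OF s])
  then have dW: "vec.dim W = 3" using L1 L2 x(3) int by (simp add: proj_space_def)
  have W2: "proj_space 2 W" using sW dW by (simp add: proj_space_def)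
  have LW: "L1 \<subseteq> W" "L2 \<subseteq> W"
    using vec.subspace_0[OF s(1)] vec.subspace_0[OF s(2)] unfolding W_def by force+
  obtain a where a: "a \<in> A" by (rule A_nonempty)
  \<comment> \<open>Going from \<open>a\<close> along \<open>L2\<close> to \<open>b\<close> and then
    along \<open>L1\<close> to \<open>c\<close> gives \<open>q * q\<close> pairs. A given
    \<open>c\<close> has at most two \<open>b\<close>, since these differ by vectors of the single
    point \<open>L1 \<inter> L2\<close>, which is at most one direction.\<close>
  let ?B = "{b \<in> A. b - a \<in> L2}" and ?C = "\<lambda>b. {c \<in> A. c - b \<in> L1}"
  have "q * q = card (Sigma ?B ?C)"
    using card_coset[OF a s(2)] card_coset[OF _ s(1)] L1(2) L2(2) q_ge by simp
  also have "\<dots> \<le> card (snd ` Sigma ?B ?C) * 2"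
  proof (rule card_le_fibres)
    fix c assume "c \<in> snd ` Sigma ?B ?C"
    then obtain b0 where b0: "b0 \<in> ?B" "c \<in> ?C b0" by auto
    have "fst ` {p \<in> Sigma ?B ?C. snd p = c} \<subseteq> {b \<in> A. b - b0 \<in> L1 \<inter> L2}"
    proof
      fix b assume "b \<in> fst ` {p \<in> Sigma ?B ?C. snd p = c}"
      then have b: "b \<in> ?B" "c \<in> ?C b" by auto
      have "(c - b0) - (c - b) \<in> L1" using b b0 vec.subspace_diff[OF s(1)] by blast
      moreover have "(b - a) - (b0 - a) \<in> L2" using b b0 vec.subspace_diff[OF s(2)] by blast
      ultimately show "b \<in> {b \<in> A. b - b0 \<in> L1 \<inter> L2}" using b by simp
    qed
    then have "card (fst ` {p \<in> Sigma ?B ?C. snd p = c}) \<le> card {b \<in> A. b - b0 \<in> L1 \<inter> L2}"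
      by (intro card_mono) auto
    also have "\<dots> = deg (vec.span {x}) + 1"
      using b0 by (simp add: int card_coset)
    also have "deg (vec.span {x}) \<le> card {vec.span {x}}"
      unfolding deg_def
    proof (rule card_mono)
      show "{P \<in> D. P \<subseteq> vec.span {x}} \<subseteq> {vec.span {x}}"
      proof
        fix P assume P: "P \<in> {P \<in> D. P \<subseteq> vec.span {x}}"
        then obtain v where v: "v \<noteq> 0" "P = vec.span {v}" using D_point by auto
        then have "v \<in> vec.span {x}" using P by (auto intro: vec.span_base)
        then show "P \<in> {vec.span {x}}" using span_singleton_eq[of v x] v by simp
      qed
    qed simp
    finally have "card (fst ` {p \<in> Sigma ?B ?C. snd p = c}) \<le> 2" by simp
    moreover have "inj_on fst {p \<in> Sigma ?B ?C. snd p = c}" by (auto simp: inj_on_def)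
    ultimately show "card {p \<in> Sigma ?B ?C. snd p = c} \<le> 2" by (simp add: card_image)
  qed simp
  also have "snd ` Sigma ?B ?C \<subseteq> {c \<in> A. c - a \<in> W}"
  proof
    fix c assume "c \<in> snd ` Sigma ?B ?C"
    then obtain b where b: "b \<in> ?B" "c \<in> ?C b" by auto
    then have "c - a = (c - b) + (b - a)" by simp
    then have "c - a \<in> W" unfolding W_def using b by blast
    then show "c \<in> {c \<in> A. c - a \<in> W}" using b by simp
  qed
  then have "card (snd ` Sigma ?B ?C) * 2 \<le> card {c \<in> A. c - a \<in> W} * 2"
    by (intro mult_right_mono card_mono) auto
  finally have big: "q * q \<le> card {c \<in> A. c - a \<in> W} * 2" .
  \<comment> \<open>A line with at most 3 directions would give \<open>q \<le> (3 + 1) * 2\<close>,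
    against \<open>q \<ge> 16\<close>.\<close>
  have degM: "deg M = q - 1" if M: "proj_line M" "M \<subseteq> W" for M
  proof -
    have "q * q \<le> q * (deg M + 1) * 2" using big card_solid_le[OF W2 M, of a] by linarith
    then have "q * q \<le> q * ((deg M + 1) * 2)" by (simp only: mult.assoc)
    then have "q \<le> (deg M + 1) * 2" using q_ge by (subst (asm) mult_le_cancel1) simp
    then show ?thesis using deg_cases[OF M(1)] q_ge by auto
  qed
  let ?\<M> = "\<lambda>y. {M. proj_line M \<and> y \<in> M \<and> M \<subseteq> W}"
  have pencil: "card (?\<M> y) = q + 1" if y: "y \<in> W" "y \<noteq> 0" for y
  proof -
    have sy: "vec.span {y} \<subseteq> M" if "vec.subspace M" "y \<in> M" for M
      using that span_singleton_subset_iff by blast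
    have "card (W - vec.span {y}) = (\<Sum>M\<in>?\<M> y. card ((W - vec.span {y}) \<inter> M))"
      by (rule card_pencil_sum[OF sW y]) simp
    also have "\<dots> = (\<Sum>M\<in>?\<M> y. q\<^sup>2 - q)"
    proof (rule sum.cong)
      fix M assume M: "M \<in> ?\<M> y"
      then have "(W - vec.span {y}) \<inter> M = M - vec.span {y}" by auto
      then show "card ((W - vec.span {y}) \<inter> M) = q\<^sup>2 - q"
        using M sy[of M] card_proj_line[of M] card_span_singleton[OF y(2)] proj_line_subspace[of M]
        by (simp add: card_Diff_subset)
    qed simp
    finally have "card (?\<M> y) * (q\<^sup>2 - q) = q ^ 3 - q"
      using sy[OF sW y(1)] card_subspace[OF sW] dW card_span_singleton[OF y(2)]
      by (simp add: card_Diff_subset)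
    also have "q ^ 3 - q = (q + 1) * (q\<^sup>2 - q)"
      by (simp add: algebra_simps power2_eq_square power3_eq_cube)
    finally have "card (?\<M> y) = q + 1 \<or> q\<^sup>2 - q = 0" by (subst (asm) mult_cancel2)
    moreover have "q\<^sup>2 - q > 0" using q_ge by (simp add: power2_eq_square)
    ultimately show ?thesis by linarith
  qed
  let ?V = "\<lambda>M. {v \<in> M. v \<noteq> 0 \<and> vec.span {v} \<in> D}"
  obtain y where y: "y \<in> L1" "y \<noteq> 0" "vec.span {y} \<notin> D" using ex_nondirection[OF L1(1)] .
  \<comment> \<open>First count: \<open>y\<close> is no direction, so each of the
    \<open>q + 1\<close> lines through it contributes all its \<open>q - 1\<close>
    directions.\<close>
  have "deg W = (q + 1) * (q - 1)"
  proof -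
    have yW: "y \<in> W" using y LW by auto
    have nV: "v \<notin> vec.span {y}" if "vec.span {v} \<in> D" "v \<noteq> 0" for v
      using span_singleton_eq[of v y] that y(3) by auto
    have "card (?V W) = (\<Sum>M\<in>?\<M> y. card (?V W \<inter> M))"
      using y LW nV by (intro card_pencil_sum[OF sW]) auto
    also have "\<dots> = (\<Sum>M\<in>?\<M> y. (q - 1) * (q - 1))"
    proof (rule sum.cong)
      fix M assume M: "M \<in> ?\<M> y"
      then have "?V W \<inter> M = ?V M" by auto
      then show "card (?V W \<inter> M) = (q - 1) * (q - 1)"
        using M card_direction_vectors[of M] proj_line_subspace[of M] degM[of M] by simp
    qed simp
    also have "\<dots> = (q + 1) * ((q - 1) * (q - 1))"
      by (simp only: sum_constant pencil[OF yW y(2)] of_nat_id)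
    finally have "(q - 1) * deg W = (q + 1) * ((q - 1) * (q - 1))"
      by (simp only: card_direction_vectors[OF sW])
    then have "(q - 1) * deg W = (q - 1) * ((q + 1) * (q - 1))" by (simp only: mult_ac)
    then show ?thesis using q_ge by (subst (asm) mult_cancel1) simp
  qed
  moreover obtain z where z: "z \<in> L1" "z \<noteq> 0" "vec.span {z} \<in> D"
  proof -
    have "{P \<in> D. P \<subseteq> L1} \<noteq> {}"
    proof
      assume "{P \<in> D. P \<subseteq> L1} = {}"
      then have "deg L1 = 0" unfolding deg_def by (simp only: card.empty)
      then show False using L1(2) q_ge by simp
    qed
    then show ?thesis using that D_point span_singleton_subset_iff[OF s(1)] by blast
  qed
  \<comment> \<open>Second count: \<open>z\<close> is a direction common to all \<open>q + 1\<close>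
    lines, and each adds \<open>q - 2\<close> others. The two totals differ by
    \<open>q\<close>.\<close>
  have "deg W = 1 + (q + 1) * (q - 2)"
  proof -
    let ?Z = "vec.span {z} - {0}"
    have ZV: "?Z \<subseteq> ?V M" if M: "vec.subspace M" "z \<in> M" for M
    proof
      fix v assume v: "v \<in> ?Z"
      then have "vec.span {v} = vec.span {z}" by (intro span_singleton_eq) auto
      then show "v \<in> ?V M" using v z(3) M span_singleton_subset_iff[OF M(1)] by auto
    qed
    have cZ: "card ?Z = q - 1"
      using card_span_singleton[OF z(2)] by (subst card_Diff_singleton) (simp_all add: vec.span_zero)
    have zW: "z \<in> W" using z LW by auto
    have "card (?V W - ?Z) = (\<Sum>M\<in>?\<M> z. card ((?V W - ?Z) \<inter> M))"
      using zW z(2) by (intro card_pencil_sum[OF sW]) auto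
    also have "\<dots> = (\<Sum>M\<in>?\<M> z. (q - 1) * (q - 2))"
    proof (rule sum.cong)
      fix M assume M: "M \<in> ?\<M> z"
      then have sM: "vec.subspace M" using proj_line_subspace by auto
      have "(?V W - ?Z) \<inter> M = ?V M - ?Z" using M by auto
      then have "card ((?V W - ?Z) \<inter> M) = (q - 1) * (q - 1) - (q - 1)"
        using M card_direction_vectors[OF sM] degM[of M] cZ ZV[OF sM] by (simp add: card_Diff_subset)
      moreover have "(q - 1) * (q - 1) - (q - 1) = (q - 1) * (q - 2)"
        by (simp add: diff_mult_distrib2)
      ultimately show "card ((?V W - ?Z) \<inter> M) = (q - 1) * (q - 2)" by simp
    qed simp
    also have "\<dots> = (q + 1) * ((q - 1) * (q - 2))"
      by (simp only: sum_constant pencil[OF zW z(2)] of_nat_id)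
    finally have "card (?V W - ?Z) = (q + 1) * ((q - 1) * (q - 2))" .
    moreover have "card (?V W - ?Z) + (q - 1) = card (?V W)"
      using ZV[OF sW zW] cZ card_mono[OF _ ZV[OF sW zW]] by (simp add: card_Diff_subset)
    ultimately have "(q - 1) * deg W = (q - 1) + (q + 1) * ((q - 1) * (q - 2))"
      using card_direction_vectors[OF sW] by linarith
    also have "\<dots> = (q - 1) * (1 + (q + 1) * (q - 2))"
      by (simp only: distrib_left[of "q - 1" 1] mult.left_commute[of "q + 1" "q - 1"] mult.right_neutral)
    finally show ?thesis using q_ge by (subst (asm) mult_cancel1) simp
  qed
  ultimately have "int ((q + 1) * (q - 1)) = int (1 + (q + 1) * (q - 2))" by simp
  then have "(int q + 1) * (int q - 1) = 1 + (int q + 1) * (int q - 2)"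
    using q_ge by (simp add: of_nat_diff)
  then show False using q_ge by (simp add: algebra_simps)
qed

section \<open>Closure under sums of three elements\<close>

text \<open>The plane through \<open>a\<close> with line at infinity \<open>L\<close> holds exactly
  four points of \<open>A\<close>. From each of them the other three occupy all three directions on
  \<open>L\<close>, so opposite sides of the quadrangle are parallel. This makes the fourth point
  \<open>a + b - c\<close>, which is \<open>a + b + c\<close> in characteristic 2.\<close>

lemma three_secant_sum:
  assumes A: "a \<in> A" "b \<in> A" "c \<in> A" "a \<noteq> b" "a \<noteq> c" "b \<noteq> c"
    and L: "proj_line L" "b - a \<in> L" "c - a \<in> L" "deg L = 3"
  shows "a + b + c \<in> A"
proof -
  let ?X = "{x \<in> A. x - a \<in> L}"
  have sL: "vec.subspace L" using L(1) by (rule proj_line_subspace)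
  have X4: "card ?X = 4" using card_coset[OF A(1) sL] L(4) by simp
  have "{a, b, c} \<subseteq> ?X" using A L vec.subspace_0[OF sL] by auto
  moreover have "card {a, b, c} = 3" using A by simp
  ultimately have "card (?X - {a, b, c}) = 1" using X4 by (simp add: card_Diff_subset)
  then obtain t where "?X - {a, b, c} = {t}" by (rule card_1_singletonE)
  then have t: "t \<in> ?X" "t \<notin> {a, b, c}" by blast+
  have diffL: "x - y \<in> L" if "x \<in> ?X" "y \<in> ?X" for x y
    using vec.subspace_diff[OF sL, of "x - a" "y - a"] that by simp
  have noncol: "vec.span {x - y} \<noteq> vec.span {x - z}"
    if "x \<in> A" "y \<in> A" "z \<in> A" "x \<noteq> y" "x \<noteq> z" "y \<noteq> z" for x y z
  proof
    assume "vec.span {x - y} = vec.span {x - z}"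
    then have "z - x \<in> vec.span {y - x}"
      by (metis span_diff_commute insertI1 vec.span_base)
    then show False using no_three_collinear[of x y z] that by blast
  qed
  \<comment> \<open>The three directions from \<open>x\<close> exhaust those on \<open>L\<close>; as
    no three points are collinear, \<open>z - w\<close> can only have the direction of
    \<open>x - y\<close>.\<close>
  have opp: "vec.span {x - y} = vec.span {z - w}"
    if "x \<in> ?X" "y \<in> ?X" "z \<in> ?X" "w \<in> ?X" "distinct [x, y, z, w]" for x y z w
  proof -
    let ?S = "{vec.span {x - y}, vec.span {x - z}, vec.span {x - w}}"
    have inS: "vec.span {u - v} \<in> {P \<in> D. P \<subseteq> L}" if "u \<in> ?X" "v \<in> ?X" "u \<noteq> v" for u v
    proof -
      have "u - v \<in> L" using that by (intro diffL)
      moreover have "vec.span {u - v} \<in> D" using that by (intro span_diff_in_D) auto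
      ultimately show ?thesis using span_singleton_subset_iff[OF sL] by blast
    qed
    have "card ?S = 3" using noncol[of x y z] noncol[of x y w] noncol[of x z w] that by auto
    moreover have "?S \<subseteq> {P \<in> D. P \<subseteq> L}" using inS that by auto
    ultimately have "?S = {P \<in> D. P \<subseteq> L}" using L(4) by (intro card_subset_eq) (auto simp: deg_def)
    then have "vec.span {z - w} \<in> ?S" using inS[of z w] that by auto
    moreover have "vec.span {z - w} \<noteq> vec.span {x - z}"
      using noncol[of z w x] that by (auto simp: span_diff_commute[of x z])
    moreover have "vec.span {z - w} \<noteq> vec.span {x - w}"
      using noncol[of w z x] that by (auto simp: span_diff_commute[of x w] span_diff_commute[of z w])
    ultimately show ?thesis by auto
  qed
  have "vec.span {t - a} = vec.span {b - c}" "vec.span {t - b} = vec.span {a - c}"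
    using opp[of t a b c] opp[of t b a c] t \<open>{a, b, c} \<subseteq> ?X\<close> A by auto
  then obtain \<alpha> \<beta> where \<alpha>: "t - a = \<alpha> *s (b - c)" and \<beta>: "t - b = \<beta> *s (a - c)"
    by (metis (no_types, lifting) insertI1 rangeE vec.span_base vec.span_singleton)
  \<comment> \<open>Comparing the two expressions for \<open>t\<close>: since \<open>b - a\<close>
    and \<open>a - c\<close> are independent, \<open>\<alpha> = 1\<close> will follow.\<close>
  have "(\<alpha> - 1) *s (b - a) = (\<beta> - \<alpha>) *s (a - c)"
  proof -
    have "(t - a) - (t - b) = \<alpha> *s (b - c) - \<beta> *s (a - c)" by (simp only: \<alpha> \<beta>)
    then have "b - a = \<alpha> *s (b - c) - \<beta> *s (a - c)" by simp
    then show ?thesis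
      by (simp add: vec.scale_left_diff_distrib vec.scale_right_diff_distrib algebra_simps)
  qed
  have "\<alpha> = 1"
  proof (rule ccontr)
    assume "\<alpha> \<noteq> 1"
    then have "b - a = inverse (\<alpha> - 1) *s ((\<alpha> - 1) *s (b - a))" by simp
    also have "\<dots> = (inverse (\<alpha> - 1) * (\<beta> - \<alpha>)) *s (a - c)"
      by (simp only: \<open>(\<alpha> - 1) *s (b - a) = (\<beta> - \<alpha>) *s (a - c)\<close> vec.scale_scale)
    finally have "b - a \<in> vec.span {a - c}" by (auto simp: vec.span_singleton)
    then have "b - a \<in> vec.span {c - a}" by (simp add: span_diff_commute[of a c])
    then show False using no_three_collinear[of a c b] A by auto
  qed
  then have "t = a + (b - c)" using \<alpha> by (simp add: algebra_simps)
  then have "t = a + b + c" by (simp only: vdiff_eq add.assoc)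
  then show ?thesis using t by simp
qed

text \<open>
  A point \<open>y\<close> for which the direction of \<open>d = a + b\<close> and that of \<open>y - a\<close> lie on a long secant is
  reached through a point \<open>c\<close> off the corresponding plane; the other lines through \<open>d\<close> are short.
\<close>

lemma sum_three_mem:
  assumes A: "a \<in> A" "b \<in> A" "y \<in> A"
  shows "y + a + b \<in> A"
proof (cases "a = b")
  case True
  then show ?thesis using A(3) by (simp add: add.assoc)
next
  case False
  define d where "d = a + b"
  have d0: "d \<noteq> 0" using False by (metis d_def vdiff_eq right_minus_eq)
  have dD: "vec.span {d} \<in> D" using span_diff_in_D[OF A(1,2) False] by (simp add: d_def vdiff_eq)
  have dd: "x + d + d = x" for x by (simp add: add.assoc)
  let ?L = "\<lambda>x y. vec.span {d, y - x}"
  have notin: "y - x \<notin> vec.span {d}"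
    if "x \<in> A" "x + d \<in> A" "y \<in> A" "y \<noteq> x" "y \<noteq> x + d" for x y
    using no_three_collinear[of x "x + d" y] that d0 by auto
  have line: "proj_line (?L x y)"
    if "x \<in> A" "x + d \<in> A" "y \<in> A" "y \<noteq> x" "y \<noteq> x + d" for x y
    using notin[OF that] d0 by (intro dim_span_two)
  \<comment> \<open>If the line at infinity is not long, \<open>three_secant_sum\<close> applies to
    \<open>x\<close>, \<open>x + d\<close> and \<open>y\<close>, and the doubled \<open>x\<close>
    cancels.\<close>
  have step: "y + d \<in> A" if "x \<in> A" "x + d \<in> A" "y \<in> A" "deg (?L x y) \<noteq> q - 1" for x y
  proof (cases "y = x \<or> y = x + d")
    case True
    then show ?thesis using that dd by auto
  next
    case False
    then have ne: "y \<noteq> x" "y \<noteq> x + d" by auto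
    have dL: "d \<in> ?L x y" and yL: "y - x \<in> ?L x y" by (auto intro: vec.span_base)
    have "vec.span {y - x} \<noteq> vec.span {d}"
      using notin[OF that(1-3) ne] vec.span_base[of "y - x" "{y - x}"] by auto
    then have "deg (?L x y) = 3"
      using deg_ge_3[OF line[OF that(1-3) ne] span_diff_in_D[OF that(3,1) ne(1)] dD] that(4)
        dL yL by (simp add: span_singleton_subset_iff)
    then have "x + (x + d) + y \<in> A"
      using three_secant_sum[OF that(1-3) _ _ _ line[OF that(1-3) ne]] ne d0 dL yL by auto
    moreover have "x + (x + d) + y = y + d" 
    proof -
      have "x + (x + d) + y = (x + x) + (y + d)" by (simp only: add_ac)
      then show ?thesis by (simp only: vadd_self add_0)
    qed
    ultimately show ?thesis by metis
  qed
  have ad: "a + d \<in> A" using A(2) by (simp add: d_def flip: add.assoc)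
  have "y + d \<in> A"
  proof (cases "deg (?L a y) = q - 1 \<and> y \<noteq> a \<and> y \<noteq> a + d")
    case False
    then consider "deg (?L a y) \<noteq> q - 1" | "y = a" | "y = a + d" by blast
    then show ?thesis using step[OF A(1) ad A(3)] ad dd A(1) by cases simp_all
  next
    case True
    let ?M = "?L a y"
    have M: "proj_line ?M" "deg ?M = q - 1" using True line[OF A(1) ad A(3)] by auto
    have sM: "vec.subspace ?M" by simp
    have "card {x \<in> A. x - a \<in> ?M} = q" using card_coset[OF A(1) sM] M(2) q_ge by simp
    then have "\<not> A \<subseteq> {x \<in> A. x - a \<in> ?M}"
      using q_lt_card_A card_mono[of "{x \<in> A. x - a \<in> ?M}" A] by auto
    then obtain c where c: "c \<in> A" "c - a \<notin> ?M" by auto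
    have dM: "d \<in> ?M" and yM: "y - a \<in> ?M" by (auto intro: vec.span_base)
    have ca: "c \<noteq> a" "c \<noteq> a + d" using c(2) dM vec.subspace_0[OF sM] by auto
    have short: "deg N \<noteq> q - 1" if "proj_line N" "d \<in> N" "N \<noteq> ?M" for N
      using long_secants_disjoint[OF that(1) _ M] that dM d0 by blast
    have caL: "c - a \<in> ?L a c" "d \<in> ?L a c" by (auto intro: vec.span_base)
    have "deg (?L a c) \<noteq> q - 1"
      using c caL by (intro short line[OF A(1) ad c(1) ca]) auto
    then have cd: "c + d \<in> A" by (rule step[OF A(1) ad c(1)])
    show ?thesis
    proof (cases "y = c \<or> y = c + d")
      case True
      then show ?thesis using c cd dd by auto
    next
      case False
      have ycL: "y - c \<in> ?L c y" "d \<in> ?L c y" by (auto intro: vec.span_base)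
      have "y - c \<notin> ?M"
      proof
        assume "y - c \<in> ?M"
        then have "(y - a) - (y - c) \<in> ?M" by (rule vec.subspace_diff[OF sM yM])
        then show False using c(2) by simp
      qed
      then have "deg (?L c y) \<noteq> q - 1"
        using ycL False by (intro short line[OF c(1) cd A(3)]) auto
      then show ?thesis by (rule step[OF c(1) cd A(3)])
    qed
  qed
  then show ?thesis by (simp add: d_def add.assoc)
qed

end

section \<open>Scattered groups and their long secants\<close>

text \<open>What the translate of \<open>A\<close> inherits. The numbers \<open>4\<close> and
  \<open>q\<close> stand for 3 and \<open>q - 1\<close> directions: each direction on a line
  contributes one vector of \<open>U\<close>, and \<open>0\<close> is counted as well.\<close>

locale scattered_group = char_two_set U q k
  for U :: "('a::{field,finite} ^ 'n) set" and q k +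
  assumes zero_U: "0 \<in> U"
    and add_U: "\<And>x y. x \<in> U \<Longrightarrow> y \<in> U \<Longrightarrow> x + y \<in> U"
    and scattered: "\<And>u c. u \<in> U \<Longrightarrow> u \<noteq> 0 \<Longrightarrow> c *s u \<in> U \<Longrightarrow> c = 0 \<or> c = 1"
    and line_U: "\<And>L. proj_line L \<Longrightarrow> card (U \<inter> L) \<le> 4 \<or> card (U \<inter> L) = q"
    and secants_U_disjoint: "\<And>L M. proj_line L \<Longrightarrow> card (U \<inter> L) = q \<Longrightarrow>
      proj_line M \<Longrightarrow> card (U \<inter> M) = q \<Longrightarrow> L \<noteq> M \<Longrightarrow> L \<inter> M = {0}"
begin

definition lsec :: "('a ^ 'n) set set" where
  "lsec = {L. proj_line L \<and> card (U \<inter> L) = q}"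

lemma diff_U: "x \<in> U \<Longrightarrow> y \<in> U \<Longrightarrow> x - y \<in> U"
  by (simp add: vdiff_eq add_U)

section \<open>The bound for scattered sets and the existence of long secants\<close>

lemma ex_scalar: obtains l :: 'a where "l \<noteq> 0" "l \<noteq> 1"
proof -
  have "\<not> (UNIV :: 'a set) \<subseteq> {0, 1}"
  proof
    assume "(UNIV :: 'a set) \<subseteq> {0, 1}"
    then have "q \<le> card {0, 1 :: 'a}" using card_mono[of "{0, 1 :: 'a}" UNIV] by simp
    then show False using q_ge by simp
  qed
  then show ?thesis using that by blast
qed

lemma span_U: "u \<in> U \<Longrightarrow> u \<noteq> 0 \<Longrightarrow> w \<in> U \<Longrightarrow> w \<in> vec.span {u} \<Longrightarrow> w = 0 \<or> w = u"
  using scattered by (fastforce simp: vec.span_singleton)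

lemma mult_in_span_cancel:
  fixes c :: 'a
  assumes "c *s x \<in> vec.span {u}" "c \<noteq> 0"
  shows "x \<in> vec.span {u}"
proof -
  have "inverse c *s (c *s x) \<in> vec.span {u}" by (rule vec.span_scale[OF assms(1)])
  then show ?thesis using assms(2) by simp
qed

text \<open>
  Multiplying by a scalar outside the prime field separates a scattered set from itself; this
  is the Blokhuis-Lavrauw bound.
\<close>

lemma scattered_bound:
  assumes X: "X \<subseteq> U" "X \<subseteq> W" and W: "vec.subspace W"
  shows "card X ^ 2 \<le> card W"
proof -
  obtain l :: 'a where l: "l \<noteq> 0" "l \<noteq> 1" by (rule ex_scalar)
  let ?f = "\<lambda>(x, y). x + l *s y"
  have "inj_on ?f (X \<times> X)"
  proof (rule inj_onI, clarify)
    fix x y x' y' assume m: "x \<in> X" "y \<in> X" "x' \<in> X" "y' \<in> X" and eq: "x + l *s y = x' + l *s y'"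
    have "l *s (y' - y) = x - x'" using eq by (simp add: vec.scale_right_diff_distrib algebra_simps)
    moreover have "x - x' \<in> U" "y' - y \<in> U" using m X by (auto intro!: diff_U simp del: diff_diff_eq)
    ultimately have "l *s (y' - y) \<in> U" "y' - y \<in> U" by simp_all
    then have "y' - y = 0" using scattered[of "y' - y" l] l by blast
    then show "x = x' \<and> y = y'" using eq by simp
  qed
  moreover have "?f ` (X \<times> X) \<subseteq> W"
    using X W by (auto intro!: vec.subspace_add vec.subspace_scale)
  ultimately have "card (X \<times> X) \<le> card W" by (intro card_inj_on_le) auto
  then show ?thesis by (simp add: card_cartesian_product power2_eq_square)
qed

text \<open>
  The same idea modulo \<open>u\<close>: if no plane through \<open>u\<close> contained more than 4 elements of \<open>U\<close>, then
  \<open>(w, w', c) \<mapsto> w + l w' + c u\<close> would be at most 4-to-1.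
\<close>

lemma ex_secant:
  assumes X: "X \<subseteq> U" "X \<subseteq> W" "\<And>x y. x \<in> X \<Longrightarrow> y \<in> X \<Longrightarrow> x - y \<in> X"
    and W: "vec.subspace W" "card W \<le> card X ^ 2" and u: "u \<in> X" "u \<noteq> 0"
  obtains L where "L \<in> lsec" "u \<in> L" "L \<subseteq> W"
proof (rule ccontr)
  assume "\<not> thesis"
  then have none: "\<And>L. L \<in> lsec \<Longrightarrow> u \<in> L \<Longrightarrow> \<not> L \<subseteq> W" using that by blast
  have uU: "u \<in> U" using u X by auto
  obtain l :: 'a where l: "l \<noteq> 0" "l \<noteq> 1" by (rule ex_scalar)
  have key: "w = 0 \<or> w = u" "w' = 0 \<or> w' = u"
    if w: "w \<in> X" "w' \<in> X" and in_span: "w + l *s w' \<in> vec.span {u}" for w w'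
  proof -
    show w': "w' = 0 \<or> w' = u"
    proof (rule ccontr)
      assume "\<not> (w' = 0 \<or> w' = u)"
      then have n: "w' \<notin> vec.span {u}" using span_U[OF uU u(2)] w X by blast
      have ns: "c *s w' \<notin> vec.span {u}" if "c \<noteq> 0" for c using mult_in_span_cancel n that by blast
      let ?L = "vec.span {u, w'}"
      have L: "proj_line ?L" using u(2) n by (rule dim_span_two)
      have uL: "u \<in> ?L" "w' \<in> ?L" by (auto intro: vec.span_base)
      have "vec.span {u} \<subseteq> ?L" by (rule vec.span_mono) auto
      then have "(w + l *s w') - l *s w' \<in> ?L"
        using in_span uL by (intro vec.span_diff vec.span_scale) auto
      then have wL: "w \<in> ?L" by simp
      have sum: "u + w' \<in> ?L" by (intro vec.span_add uL)
      \<comment> \<open>Five elements of \<open>U\<close> on \<open>?L\<close> make it long by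
        \<open>line_U\<close>; it lies in \<open>W\<close> and passes through \<open>u\<close>,
        which was excluded.\<close>
      have "distinct [0, u, w', u + w', w]"
      proof -
        have "u \<noteq> w'" "w' \<noteq> 0" "u + w' \<noteq> u" using n by (auto intro: vec.span_base vec.span_zero)
        moreover have "u + w' \<noteq> w'" using u(2) by simp
        moreover have "u + w' \<noteq> 0"
        proof
          assume "u + w' = 0"
          then have "w' = - u" by (simp add: eq_neg_iff_add_eq_0 add.commute)
          then show False using n by (auto intro: vec.span_neg vec.span_base)
        qed
        moreover have "w \<noteq> 0" using ns[OF l(1)] in_span by auto
        moreover have "w \<noteq> u"
        proof
          assume "w = u"
          then have "(w + l *s w') - u \<in> vec.span {u}" using in_span by (intro vec.span_diff) (auto intro: vec.span_base)
          then show False using ns[OF l(1)] \<open>w = u\<close> by simp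
        qed
        moreover have l1: "(1 + l) *s w' \<notin> vec.span {u}"
          using ns[of "1 + l"] l(2) char2 by (metis add_left_cancel)
        moreover have "w \<noteq> w'"
          using l1 in_span by (auto simp: vec.scale_left_distrib)
        moreover have "w \<noteq> u + w'"
        proof
          assume "w = u + w'"
          then have "(w + l *s w') - u \<in> vec.span {u}" using in_span by (intro vec.span_diff) (auto intro: vec.span_base)
          then show False using l1 \<open>w = u + w'\<close> by (simp add: vec.scale_left_distrib)
        qed
        ultimately show ?thesis using u(2) by auto
      qed
      then have "card (set [0, u, w', u + w', w]) = 5" by (subst distinct_card) auto
      moreover have "set [0, u, w', u + w', w] \<subseteq> U \<inter> ?L"
        using uL wL sum w X uU zero_U add_U[of u w'] vec.span_zero by auto
      then have "card (set [0, u, w', u + w', w]) \<le> card (U \<inter> ?L)" by (intro card_mono) auto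
      ultimately have "card (U \<inter> ?L) = q" using line_U[OF L] by simp
      then have "?L \<in> lsec" using L by (simp add: lsec_def)
      moreover have "?L \<subseteq> W" using u w X W by (intro vec.span_minimal) auto
      ultimately show False using none uL by blast
    qed
    have "(w + l *s w') - l *s w' \<in> vec.span {u}"
      using in_span w' by (intro vec.span_diff vec.span_scale) (auto intro: vec.span_base vec.span_zero)
    then show "w = 0 \<or> w = u" using span_U[OF uU u(2)] w X by auto
  qed
  let ?X = "X \<times> X \<times> (UNIV :: 'a set)"
  let ?f = "\<lambda>(w, w', c). w + l *s w' + c *s u"
  have "card ?X \<le> card (?f ` ?X) * 4"
  proof (rule card_le_fibres)
    fix y assume "y \<in> ?f ` ?X"
    then obtain w0 w0' c0 where w0: "w0 \<in> X" "w0' \<in> X" "y = w0 + l *s w0' + c0 *s u" by auto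
    let ?F = "{p \<in> ?X. ?f p = y}"
    \<comment> \<open>Relative to a fixed preimage, the first two components change by
      \<open>0\<close> or \<open>u\<close>, and the scalar is then determined: at most 4
      preimages.\<close>
    let ?h = "\<lambda>(w, w', c :: 'a). (w - w0, w' - w0')"
    have "inj_on ?h ?F"
      using u(2) by (auto simp: inj_on_def)
    moreover have "?h ` ?F \<subseteq> {0, u} \<times> {0, u}"
    proof
      fix d assume "d \<in> ?h ` ?F"
      then obtain w w' c where w: "w \<in> X" "w' \<in> X" and y: "w + l *s w' + c *s u = y"
        and d: "d = (w - w0, w' - w0')" by auto
      have "(w - w0) + l *s (w' - w0') = (c0 - c) *s u"
        using y w0(3) by (simp add: vec.scale_right_diff_distrib vec.scale_left_diff_distrib algebra_simps)
      then have "(w - w0) + l *s (w' - w0') \<in> vec.span {u}" by (auto simp: vec.span_singleton)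
      then show "d \<in> {0, u} \<times> {0, u}"
        using key[of "w - w0" "w' - w0'"] X(3) w w0 d by blast
    qed
    ultimately have "card ?F \<le> card ({0, u} \<times> {0, u})" by (intro card_inj_on_le) auto
    then show "card ?F \<le> 4" using u(2) by (simp add: card_cartesian_product)
  qed simp
  also have "?f ` ?X \<subseteq> W"
    using X W u by (auto intro!: vec.subspace_add vec.subspace_scale)
  then have "card (?f ` ?X) * 4 \<le> card W * 4" by (intro mult_right_mono card_mono) auto
  also have "\<dots> \<le> card X ^ 2 * 4" using W(2) by simp
  finally have "card X ^ 2 * q \<le> card X ^ 2 * 4"
    by (simp add: card_cartesian_product power2_eq_square)
  moreover have "card X > 0" using u by (auto simp: card_gt_0_iff)
  ultimately show False using q_ge by simp
qed

section \<open>Long secants and the solids spanned by two of them\<close>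

lemma lsec_line: "L \<in> lsec \<Longrightarrow> proj_line L"
  and lsec_subspace: "L \<in> lsec \<Longrightarrow> vec.subspace L"
  and lsec_card: "L \<in> lsec \<Longrightarrow> card (U \<inter> L) = q"
  by (auto simp: lsec_def proj_space_def)

lemma lsec_Int: "L \<in> lsec \<Longrightarrow> M \<in> lsec \<Longrightarrow> L \<noteq> M \<Longrightarrow> L \<inter> M = {0}"
  using secants_U_disjoint by (auto simp: lsec_def)

lemma lsec_eq: "L \<in> lsec \<Longrightarrow> M \<in> lsec \<Longrightarrow> x \<in> L \<Longrightarrow> x \<in> M \<Longrightarrow> x \<noteq> 0 \<Longrightarrow> L = M"
  using lsec_Int by blast

lemma lsec_ex_U:
  assumes "L \<in> lsec" obtains u where "u \<in> U" "u \<in> L" "u \<noteq> 0"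
proof -
  have "\<not> U \<inter> L \<subseteq> {0}"
  proof
    assume "U \<inter> L \<subseteq> {0}"
    then have "card (U \<inter> L) \<le> card {0 :: 'a ^ 'n}" by (intro card_mono) auto
    then show False using lsec_card[OF assms] q_ge by simp
  qed
  then show ?thesis using that by blast
qed

lemma lsec_direct:
  assumes "L \<in> lsec" "M \<in> lsec" "L \<noteq> M" "x \<in> L" "x' \<in> L" "y \<in> M" "y' \<in> M" "x + y = x' + y'"
  shows "x = x' \<and> y = y'"
  using assms lsec_Int lsec_subspace by (intro direct_sum_unique[of L M]) auto

lemma lsec_sum_nonzero:
  assumes "L \<in> lsec" "M \<in> lsec" "L \<noteq> M" "x \<in> L" "y \<in> M" "x \<noteq> 0"
  shows "x + y \<noteq> 0"
  using lsec_direct[OF assms(1-3), of x 0 y 0] assms lsec_subspace vec.subspace_0 by auto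

lemma card_lsec_ssum:
  assumes "L \<in> lsec" "M \<in> lsec" "L \<noteq> M"
  shows "card (ssum L M) = q ^ 4" "vec.dim (ssum L M) = 4"
proof -
  have "card (ssum L M) = card L * card M"
    using lsec_direct[OF assms] by (intro card_ssum) blast
  also have "\<dots> = q ^ 4"
    using card_proj_line[of L] card_proj_line[of M] lsec_line assms by (simp add: power2_eq_square power4_eq_xxxx)
  finally show "card (ssum L M) = q ^ 4" .
  show "vec.dim (ssum L M) = 4"
    using dim_ssum[of L M] lsec_Int[OF assms] assms lsec_line by (simp add: proj_space_def)
qed

text \<open>The sums of elements of \<open>U \<inter> L\<close> and \<open>U \<inter> M\<close>
  number \<open>q ^ 2\<close> already, and \<open>scattered_bound\<close> allows no more in a space
  of \<open>q ^ 4\<close> vectors.\<close>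

lemma U_ssum:
  assumes L: "L \<in> lsec" "M \<in> lsec" "L \<noteq> M"
  shows "U \<inter> ssum L M = ssum (U \<inter> L) (U \<inter> M)" "card (U \<inter> ssum L M) = q ^ 2"
proof -
  have c: "card (ssum (U \<inter> L) (U \<inter> M)) = q ^ 2"
  proof -
    have "card (ssum (U \<inter> L) (U \<inter> M)) = card (U \<inter> L) * card (U \<inter> M)"
      using lsec_direct[OF L] by (intro card_ssum) blast
    then show ?thesis using lsec_card L by (simp add: power2_eq_square)
  qed
  have "card (U \<inter> ssum L M) ^ 2 \<le> card (ssum L M)"
    using L by (intro scattered_bound subspace_ssum lsec_subspace) auto
  then have "card (U \<inter> ssum L M) ^ 2 \<le> (q ^ 2) ^ 2"
    using card_lsec_ssum[OF L] by (simp flip: power_mult)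
  then have le: "card (U \<inter> ssum L M) \<le> q ^ 2" by (simp only: power2_nat_le_eq_le)
  have sub: "ssum (U \<inter> L) (U \<inter> M) \<subseteq> U \<inter> ssum L M"
    by (auto elim!: ssumE intro: add_U ssumI)
  show eq: "U \<inter> ssum L M = ssum (U \<inter> L) (U \<inter> M)"
    using card_seteq[OF _ sub] le c by auto
  show "card (U \<inter> ssum L M) = q ^ 2" by (simp only: eq c)
qed

lemma U_components:
  assumes L: "L \<in> lsec" "M \<in> lsec" "L \<noteq> M" and x: "x \<in> L" "y \<in> M" "x + y \<in> U"
  shows "x \<in> U \<and> y \<in> U"
proof -
  have "x + y \<in> ssum (U \<inter> L) (U \<inter> M)" using U_ssum(1)[OF L] ssumI[OF x(1,2)] x(3) by auto
  then obtain x' y' where "x' \<in> U \<inter> L" "y' \<in> U \<inter> M" "x + y = x' + y'" by (rule ssumE)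
  then show ?thesis using lsec_direct[OF L x(1) _ x(2), of x' y'] by auto
qed

text \<open>\<open>U \<inter> ssum L M\<close> attains the bound of \<open>scattered_bound\<close>,
  so \<open>ex_secant\<close> applies inside the solid.\<close>

lemma secant_through_sum:
  assumes L: "L \<in> lsec" "M \<in> lsec" "L \<noteq> M"
    and u: "u \<in> U" "u \<in> L" and v: "v \<in> U" "v \<in> M" and nz: "u + v \<noteq> 0"
  obtains N where "N \<in> lsec" "u + v \<in> N" "N \<subseteq> ssum L M"
proof (rule ex_secant[of "U \<inter> ssum L M" "ssum L M" "u + v"])
  have s: "vec.subspace (ssum L M)" using L by (intro subspace_ssum lsec_subspace)
  show "vec.subspace (ssum L M)" by (rule s)
  show "x - y \<in> U \<inter> ssum L M" if "x \<in> U \<inter> ssum L M" "y \<in> U \<inter> ssum L M" for x y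
    using that diff_U vec.subspace_diff[OF s] by blast
  show "card (ssum L M) \<le> (card (U \<inter> ssum L M))\<^sup>2"
    by (simp add: U_ssum(2)[OF L] card_lsec_ssum[OF L])
  show "u + v \<in> U \<inter> ssum L M" using u v by (auto intro: add_U ssumI)
qed (use nz that in auto)

text \<open>If \<open>N\<close> shares a nonzero element of \<open>U\<close> with the solid, then
  \<open>N\<close> is the secant through it inside the solid. Otherwise \<open>U\<close> would have
  \<open>q ^ 3\<close> elements in a space of dimension at most 5, and
  \<open>scattered_bound\<close> would give \<open>q ^ 6 \<le> q ^ 5\<close>.\<close>

lemma lsec_subset_ssum:
  assumes L: "L \<in> lsec" "M \<in> lsec" "L \<noteq> M" "N \<in> lsec" and z: "z \<in> N" "z \<in> ssum L M" "z \<noteq> 0"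
  shows "N \<subseteq> ssum L M"
proof (cases "\<exists>u\<in>U \<inter> N. u \<in> ssum L M \<and> u \<noteq> 0")
  case True
  then obtain u where u: "u \<in> U" "u \<in> N" "u \<in> ssum L M" "u \<noteq> 0" by auto
  then obtain x y where xy: "x \<in> U" "x \<in> L" "y \<in> U" "y \<in> M" "u = x + y"
    using U_ssum(1)[OF L(1-3)] by (metis Int_iff ssumE)
  obtain N' where "N' \<in> lsec" "u \<in> N'" "N' \<subseteq> ssum L M"
    using secant_through_sum[OF L(1-3) xy(1-4)] u(4) xy(5) by metis
  then show ?thesis using lsec_eq[of N N' u] u L by auto
next
  case False
  let ?W = "ssum (ssum L M) N" and ?X = "ssum (U \<inter> ssum L M) (U \<inter> N)"
  have s: "vec.subspace (ssum L M)" "vec.subspace N" using L by (auto intro: subspace_ssum lsec_subspace)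
  have "vec.dim (vec.span {z}) \<le> vec.dim (ssum L M \<inter> N)"
    using z s by (intro vec.dim_subset) (simp add: span_singleton_subset_iff)
  then have "vec.dim (ssum L M \<inter> N) \<ge> 1" using z(3) by simp
  then have "vec.dim ?W \<le> 5"
    using dim_ssum[OF s] card_lsec_ssum(2)[OF L(1-3)] lsec_line[OF L(4)] by (simp add: proj_space_def)
  then have "card ?W \<le> q ^ 5"
    using card_subspace[OF subspace_ssum[OF s]] q_ge by (simp add: power_increasing)
  moreover have "card ?X = q ^ 3"
  proof -
    have "card ?X = card (U \<inter> ssum L M) * card (U \<inter> N)"
    proof (rule card_ssum)
      fix x x' y y' assume x: "x \<in> U \<inter> ssum L M" "x' \<in> U \<inter> ssum L M"
        and y: "y \<in> U \<inter> N" "y' \<in> U \<inter> N" and eq: "x + y = x' + y'"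
      have "x - x' = y' - y" using eq by (simp add: algebra_simps)
      moreover have "x - x' \<in> ssum L M" using x by (auto intro: vec.subspace_diff[OF s(1)])
      moreover have "y' - y \<in> U \<inter> N" using y diff_U by (auto intro: vec.subspace_diff[OF s(2)])
      ultimately have "y' - y = 0" using False by metis
      then show "x = x' \<and> y = y'" using eq by simp
    qed
    then show ?thesis using U_ssum(2)[OF L(1-3)] lsec_card[OF L(4)] by (simp add: power2_eq_square power3_eq_cube)
  qed
  moreover have "card ?X ^ 2 \<le> card ?W"
    using subspace_ssum[OF s] by (intro scattered_bound) (auto elim!: ssumE intro: add_U ssumI)
  ultimately have "q ^ 6 \<le> q ^ 5" by (simp flip: power_mult)
  then show ?thesis using q_ge by simp
qed

lemma ssum_exchange:
  assumes L: "L \<in> lsec" "M \<in> lsec" "N \<in> lsec" "L \<noteq> M" "L \<noteq> N" "M \<noteq> N" and sub: "N \<subseteq> ssum L M"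
  shows "M \<subseteq> ssum L N"
proof -
  obtain z where z: "z \<in> N" "z \<noteq> 0" using lsec_ex_U[OF L(3)] by metis
  then obtain x y where xy: "x \<in> L" "y \<in> M" "z = x + y" using subset_ssumE[OF sub] by metis
  have "y \<noteq> 0" using xy z lsec_eq[OF L(1,3), of x] L(5) by auto
  moreover have "y = - x + z" using xy by simp
  then have "y \<in> ssum L N" using ssumI[of "- x" L z N] xy z vec.subspace_neg[OF lsec_subspace[OF L(1)]] by simp
  ultimately show ?thesis using lsec_subset_ssum[OF L(1,3,5,2)] xy by blast
qed

section \<open>Long secants in a solid as graphs\<close>

text \<open>Projection along \<open>M\<close> is injective on \<open>N\<close> because the two lines
  are disjoint; \<open>N\<close> and \<open>L\<close> have equal size, so it is onto
  \<open>L\<close> and \<open>N\<close> is the graph of a map from \<open>L\<close> to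
  \<open>M\<close>.\<close>

lemma graph_ex:
  assumes L: "L \<in> lsec" "M \<in> lsec" "N \<in> lsec" "L \<noteq> M" "L \<noteq> N" "M \<noteq> N" and sub: "N \<subseteq> ssum L M"
    and x: "x \<in> L"
  obtains y where "y \<in> M" "x + y \<in> N"
proof -
  have "\<forall>z\<in>N. \<exists>x\<in>L. \<exists>y\<in>M. z = x + y" using subset_ssumE[OF sub] by metis
  then obtain p where p: "\<And>z. z \<in> N \<Longrightarrow> p z \<in> L \<and> (\<exists>y\<in>M. z = p z + y)" by metis
  have "inj_on p N"
  proof (rule inj_onI)
    fix z z' assume z: "z \<in> N" "z' \<in> N" and eq: "p z = p z'"
    obtain y y' where y: "y \<in> M" "z = p z + y" "y' \<in> M" "z' = p z' + y'" using p z by metis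
    have "z - z' = y - y'" using y(2,4) eq by (metis add_diff_cancel_left)
    moreover have "z - z' \<in> N" "y - y' \<in> M" using z y vec.subspace_diff lsec_subspace L by blast+
    ultimately have "z - z' \<in> M \<inter> N" by simp
    then show "z = z'" using lsec_Int[OF L(2,3,6)] by simp
  qed
  then have "card (p ` N) = card L" using card_proj_line[of L] card_proj_line[of N] lsec_line L by (simp add: card_image)
  then have "p ` N = L" using p by (intro card_subset_eq) auto
  then obtain z where "z \<in> N" "p z = x" using x by auto
  then show ?thesis using p that by metis
qed

text \<open>The same projection takes \<open>N \<inter> U\<close> into \<open>L \<inter> U\<close>
  by \<open>U_components\<close>, and both have \<open>q\<close> elements.\<close>

lemma graph_U:
  assumes L: "L \<in> lsec" "M \<in> lsec" "N \<in> lsec" "L \<noteq> M" "L \<noteq> N" "M \<noteq> N" and sub: "N \<subseteq> ssum L M"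
    and x: "x \<in> L" "y \<in> M" "x + y \<in> N" "x \<in> U"
  shows "y \<in> U" "x + y \<in> U"
proof -
  have "\<forall>z\<in>N \<inter> U. \<exists>x\<in>L \<inter> U. \<exists>y\<in>M. z = x + y"
  proof
    fix z assume z: "z \<in> N \<inter> U"
    then obtain x y where "x \<in> L" "y \<in> M" "z = x + y" using subset_ssumE[OF sub] by (metis Int_iff)
    then show "\<exists>x\<in>L \<inter> U. \<exists>y\<in>M. z = x + y" using U_components[OF L(1,2,4)] z by blast
  qed
  then obtain p where p: "\<And>z. z \<in> N \<inter> U \<Longrightarrow> p z \<in> L \<inter> U \<and> (\<exists>y\<in>M. z = p z + y)" by metis
  have "inj_on p (N \<inter> U)"
  proof (rule inj_onI)
    fix z z' assume z: "z \<in> N \<inter> U" "z' \<in> N \<inter> U" and eq: "p z = p z'"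
    obtain y y' where y: "y \<in> M" "z = p z + y" "y' \<in> M" "z' = p z' + y'" using p z by metis
    have "z - z' = y - y'" using y(2,4) eq by (metis add_diff_cancel_left)
    moreover have "z - z' \<in> N" "y - y' \<in> M" using z y vec.subspace_diff lsec_subspace L by blast+
    ultimately have "z - z' \<in> M \<inter> N" by simp
    then show "z = z'" using lsec_Int[OF L(2,3,6)] by simp
  qed
  then have "card (p ` (N \<inter> U)) = card (L \<inter> U)" 
    using lsec_card L by (simp add: card_image Int_commute)
  moreover have "p ` (N \<inter> U) \<subseteq> L \<inter> U" using p by blast
  ultimately have "p ` (N \<inter> U) = L \<inter> U" by (intro card_subset_eq) auto
  then have "x \<in> p ` (N \<inter> U)" using x by simp
  then obtain z where z: "z \<in> N \<inter> U" "p z = x" by auto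
  then obtain y' where y': "y' \<in> M" "z = x + y'" using p by metis
  have "(x + y) - z \<in> N" using x z vec.subspace_diff lsec_subspace L by blast
  moreover have "(x + y) - z = y - y'" using y' by simp
  moreover have "y - y' \<in> M" using x y' vec.subspace_diff lsec_subspace L by blast
  ultimately have "y - y' \<in> M \<inter> N" by simp
  then have "y = y'" using lsec_Int[OF L(2,3,6)] by simp
  then show "x + y \<in> U" using y' z by simp
  then show "y \<in> U" using U_components[OF L(1,2,4) x(1,2)] by simp
qed

section \<open>Holes: vectors of long secants outside the direction set\<close>

text \<open>These vectors represent the points of a long secant that miss the linear set, two on
  each secant by \<open>card_holes\<close>. Vectors are used in place of points so that holes can be
  added.\<close>

definition hole :: "'a ^ 'n \<Rightarrow> bool" where
  "hole e \<longleftrightarrow> e \<in> \<Union>lsec \<and> e \<noteq> 0 \<and> (\<forall>c. c *s e \<in> U \<longrightarrow> c = 0)"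

lemma hole_nonzero: "hole e \<Longrightarrow> e \<noteq> 0"
  by (simp add: hole_def)

lemma hole_scale:
  assumes "hole e" "c \<noteq> 0"
  shows "hole (c *s e)"
proof -
  obtain L where "L \<in> lsec" "e \<in> L" using assms by (auto simp: hole_def)
  then have "c *s e \<in> \<Union>lsec" using lsec_subspace vec.subspace_scale by blast
  then show ?thesis using assms by (auto simp: hole_def vec.scale_scale)
qed

lemma hole_span: "hole e \<Longrightarrow> x \<in> vec.span {e} \<Longrightarrow> x \<noteq> 0 \<Longrightarrow> hole x"
  by (auto simp: in_span_singleton intro: hole_scale)

lemma hole_line:
  assumes "hole e" obtains L where "L \<in> lsec" "e \<in> L"
  using assms by (auto simp: hole_def)

text \<open>\<open>graph_U\<close> works from \<open>L\<close> to \<open>M\<close> and back, so a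
  vector with no nonzero multiple in \<open>U\<close> is matched with another of this kind;
  \<open>U_components\<close> handles the sum.\<close>

lemma graph_hole:
  assumes L: "L \<in> lsec" "M \<in> lsec" "N \<in> lsec" "L \<noteq> M" "L \<noteq> N" "M \<noteq> N" and sub: "N \<subseteq> ssum L M"
    and x: "x \<in> L" "y \<in> M" "x + y \<in> N" "hole x"
  shows "hole y" "hole (x + y)"
proof -
  have x0: "x \<noteq> 0" using x by (simp add: hole_def)
  have y0: "y \<noteq> 0" using lsec_eq[OF L(1,3), of x] x x0 L(5) by auto
  show "hole y"
    unfolding hole_def
  proof (intro conjI allI impI y0)
    show "y \<in> \<Union>lsec" using L x by auto
    fix c assume "c *s y \<in> U"
    moreover have "c *s y + c *s x \<in> N"
      using vec.subspace_scale[OF lsec_subspace[OF L(3)] x(3), of c] by (simp add: vec.scale_right_distrib add.commute)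
    moreover have "c *s y \<in> M" "c *s x \<in> L" using x L lsec_subspace vec.subspace_scale by blast+
    moreover have "N \<subseteq> ssum M L" using sub by (simp add: ssum_commute)
    ultimately have "c *s x \<in> U" using graph_U(1)[OF L(2,1,3) L(4)[symmetric] L(6,5)] by blast
    then show "c = 0" using x(4) by (simp add: hole_def)
  qed
  show "hole (x + y)"
    unfolding hole_def
  proof (intro conjI allI impI)
    show "x + y \<in> \<Union>lsec" using L x by auto
    show "x + y \<noteq> 0" by (rule lsec_sum_nonzero[OF L(1,2,4) x(1,2) x0])
    fix c assume "c *s (x + y) \<in> U"
    then have "c *s x + c *s y \<in> U" by (simp add: vec.scale_right_distrib)
    moreover have "c *s y \<in> M" "c *s x \<in> L" using x L lsec_subspace vec.subspace_scale by blast+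
    ultimately have "c *s x \<in> U" using U_components[OF L(1,2,4)] by blast
    then show "c = 0" using x(4) by (simp add: hole_def)
  qed
qed

lemma card_span_minus_zero: "x \<noteq> 0 \<Longrightarrow> card (vec.span {x :: 'a ^ 'n} - {0}) = q - 1"
  using card_span_singleton[of x] by (subst card_Diff_singleton) (simp_all add: vec.span_zero)

lemma card_U_minus_zero: "L \<in> lsec \<Longrightarrow> card (U \<inter> L - {0}) = q - 1"
  using lsec_card[of L] zero_U vec.subspace_0[OF lsec_subspace] by (subst card_Diff_singleton) auto

text \<open>Since \<open>U\<close> is scattered, every other nonzero vector of \<open>L\<close> is
  \<open>c *s u\<close> for exactly one \<open>c \<noteq> 0\<close> and one nonzero
  \<open>u \<in> U \<inter> L\<close>. Of \<open>q * q - 1\<close> vectors this leaves as many as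
  two points have.\<close>

lemma card_holes:
  assumes L: "L \<in> lsec"
  shows "card {e \<in> L. hole e} = (q - 1) + (q - 1)"
proof -
  let ?N = "{v \<in> L. v \<noteq> 0 \<and> \<not> hole v}" and ?H = "{e \<in> L. hole e}"
  let ?f = "\<lambda>(c, u). c *s u" and ?X = "(UNIV - {0 :: 'a}) \<times> (U \<inter> L - {0})"
  have "?N = ?f ` ?X"
  proof
    show "?N \<subseteq> ?f ` ?X"
    proof
      fix v assume v: "v \<in> ?N"
      then obtain c where c: "c \<noteq> 0" "c *s v \<in> U" using L by (auto simp: hole_def)
      then have "v = ?f (inverse c, c *s v)" by simp
      moreover have "c *s v \<in> L" using v vec.subspace_scale[OF lsec_subspace[OF L]] by simp
      ultimately show "v \<in> ?f ` ?X" using c v by (intro image_eqI[of v ?f "(inverse c, c *s v)"]) auto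
    qed
    show "?f ` ?X \<subseteq> ?N"
    proof
      fix v assume "v \<in> ?f ` ?X"
      then obtain c u where cu: "c \<noteq> 0" "u \<in> U" "u \<in> L" "u \<noteq> 0" "v = c *s u" by auto
      then have "inverse c *s v \<in> U" by simp
      then have "\<not> hole v" using cu(1) by (auto simp: hole_def)
      then show "v \<in> ?N" using cu vec.subspace_scale[OF lsec_subspace[OF L]] by simp
    qed
  qed
  moreover have "inj_on ?f ?X"
  proof (rule inj_onI)
    fix p p' assume p: "p \<in> ?X" "p' \<in> ?X" and eq: "?f p = ?f p'"
    obtain c u c' u' where pp: "p = (c, u)" "p' = (c', u')" by (meson surj_pair)
    have "(inverse c' * c) *s u = inverse c' *s (c *s u)" by simp
    also have "\<dots> = u'" using eq p pp by simp
    finally have u': "(inverse c' * c) *s u = u'" .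
    then have "inverse c' * c = 0 \<or> inverse c' * c = 1"
      using p pp scattered[of u "inverse c' * c"] by auto
    then have "inverse c' * c = 1" using p pp by auto
    then have "c = c'" using p pp by (simp add: field_simps)
    then show "p = p'" using u' p pp by simp
  qed
  ultimately have "card ?N = card ?X" by (simp only: card_image)
  also have "\<dots> = (q - 1) * (q - 1)"
    using card_U_minus_zero[OF L] by (simp add: card_cartesian_product)
  finally have N: "card ?N = (q - 1) * (q - 1)" .
  have "L - {0} = ?H \<union> ?N" by (auto simp: hole_def)
  then have "card (L - {0}) = card ?H + card ?N"
    by (metis (no_types, lifting) card_Un_disjoint disjoint_iff finite mem_Collect_eq)
  moreover have "card (L - {0}) = q * q - 1"
    using card_proj_line[OF lsec_line[OF L]] vec.subspace_0[OF lsec_subspace[OF L]]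
    by (subst card_Diff_singleton) (auto simp: power2_eq_square)
  moreover have "q * q - 1 = ((q - 1) + (q - 1)) + (q - 1) * (q - 1)"
    using q_ge by (cases q) auto
  ultimately show ?thesis using N by linarith
qed

lemma holes_of_line:
  assumes L: "L \<in> lsec" and n: "hole n" "n \<in> L"
  obtains n' where "hole n'" "n' \<in> L" "n' \<notin> vec.span {n}"
    "\<And>e. hole e \<Longrightarrow> e \<in> L \<Longrightarrow> e \<in> vec.span {n} \<or> e \<in> vec.span {n'}"
proof -
  let ?H = "{e \<in> L. hole e}"
  have sub: "vec.span {e} - {0} \<subseteq> ?H" if "e \<in> ?H" for e
    using that hole_span[of e] span_singleton_subset_iff[OF lsec_subspace[OF L]] by auto
  have "\<not> ?H \<subseteq> vec.span {n} - {0}"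
  proof
    assume "?H \<subseteq> vec.span {n} - {0}"
    then have "card ?H \<le> card (vec.span {n} - {0})" by (intro card_mono) auto
    then show False using card_holes[OF L] card_span_minus_zero hole_nonzero[OF n(1)] q_ge by simp
  qed
  then obtain n' where n': "n' \<in> ?H" "n' \<notin> vec.span {n}" using hole_nonzero by auto
  have "(vec.span {n} - {0}) \<inter> (vec.span {n'} - {0}) = {}"
  proof (rule ccontr)
    assume "(vec.span {n} - {0}) \<inter> (vec.span {n'} - {0}) \<noteq> {}"
    then obtain e where e: "e \<in> vec.span {n}" "e \<in> vec.span {n'}" "e \<noteq> 0" by auto
    then have "vec.span {n} = vec.span {n'}" using span_singleton_eq by metis
    then show False using n'(2) by (auto intro: vec.span_base)
  qed
  then have "card ((vec.span {n} - {0}) \<union> (vec.span {n'} - {0})) = (q - 1) + (q - 1)"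
    using n n' hole_nonzero card_span_minus_zero by (subst card_Un_disjoint) auto
  moreover have "(vec.span {n} - {0}) \<union> (vec.span {n'} - {0}) \<subseteq> ?H"
    using sub n n' by blast
  ultimately have "(vec.span {n} - {0}) \<union> (vec.span {n'} - {0}) = ?H"
    using card_holes[OF L] by (intro card_subset_eq) auto
  then have "e \<in> vec.span {n} \<or> e \<in> vec.span {n'}" if "hole e" "e \<in> L" for e
    using that by blast
  then show ?thesis using that n' by blast
qed

lemma two_holes:
  assumes L: "L \<in> lsec" and m: "hole m" "m \<in> L" "hole m'" "m' \<in> L" "m' \<notin> vec.span {m}"
    and e: "hole e" "e \<in> L"
  shows "e \<in> vec.span {m} \<or> e \<in> vec.span {m'}"
proof -
  obtain n' where n': "\<And>e. hole e \<Longrightarrow> e \<in> L \<Longrightarrow> e \<in> vec.span {m} \<or> e \<in> vec.span {n'}"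
    using holes_of_line[OF L m(1,2)] by metis
  then have "m' \<in> vec.span {n'}" using m by blast
  then have "vec.span {m'} = vec.span {n'}" using hole_nonzero[OF m(3)] by (rule span_singleton_eq)
  then show ?thesis using n'[OF e] by simp
qed

lemma ex_hole:
  assumes L: "L \<in> lsec" obtains n where "hole n" "n \<in> L"
proof -
  have "{e \<in> L. hole e} \<noteq> {}"
  proof
    assume "{e \<in> L. hole e} = {}"
    then have "card {e \<in> L. hole e} = 0" by (simp only: card.empty)
    then show False using card_holes[OF L] q_ge by simp
  qed
  then show ?thesis using that by blast
qed

section \<open>Matching the holes of two long secants\<close>

text \<open>Brings a long secant through \<open>x + y\<close> into the position that
  \<open>graph_ex\<close> and \<open>graph_U\<close> require.\<close>

lemma covered_sum:
  assumes L: "L \<in> lsec" "M \<in> lsec" "L \<noteq> M" and x: "x \<in> L" "y \<in> M" "x \<noteq> 0" "y \<noteq> 0"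
    and cov: "x + y \<in> \<Union>lsec"
  obtains N where "N \<in> lsec" "x + y \<in> N" "N \<subseteq> ssum L M" "L \<noteq> N" "M \<noteq> N"
proof -
  obtain N where N: "N \<in> lsec" "x + y \<in> N" using cov by auto
  have "N \<subseteq> ssum L M"
    using lsec_subset_ssum[OF L N] ssumI[OF x(1,2)] lsec_sum_nonzero[OF L x(1-3)] by blast
  moreover have "L \<noteq> N"
  proof
    assume "L = N"
    then have "(x + y) - x \<in> L" using N x vec.subspace_diff lsec_subspace by blast
    then show False using lsec_eq[OF L(1,2), of y] x L(3) by simp
  qed
  moreover have "M \<noteq> N"
  proof
    assume "M = N"
    then have "(x + y) - y \<in> M" using N x vec.subspace_diff lsec_subspace by blast
    then show False using lsec_eq[OF L(1,2), of x] x L(3) by simp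
  qed
  ultimately show ?thesis using that N by blast
qed

text \<open>
  If two secants of \<open>L + M\<close> matched the holes of \<open>L\<close> with those of \<open>M\<close> differently, the induced
  permutation of \<open>U \<inter> L\<close> would be the restriction of a linear map \<open>g\<close> that interchanges the two
  holes. Then \<open>g\<^sup>2\<close> is a scalar, so it is the identity because \<open>U\<close> is scattered, and an involution
  in characteristic 2 has a nonzero fixed vector; the two secants would share a point.
\<close>

lemma no_swap:
  assumes L: "L \<in> lsec" "M \<in> lsec" "L \<noteq> M"
    and n: "hole n" "n \<in> L" and m: "hole m" "m \<in> M" "hole m'" "m' \<in> M"
    and c: "c \<noteq> 0" and cov: "n + m \<in> \<Union>lsec" "c *s n + m' \<in> \<Union>lsec"
  shows "m' \<in> vec.span {m}"
proof (rule ccontr)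
  assume m'm: "m' \<notin> vec.span {m}"
  have sL: "vec.subspace L" and sM: "vec.subspace M" using L lsec_subspace by auto
  have nz: "n \<noteq> 0" "m \<noteq> 0" "m' \<noteq> 0" using n m hole_nonzero by auto
  have cn: "c *s n \<in> L" "c *s n \<noteq> 0" using n c nz vec.subspace_scale[OF sL] by auto
  obtain N where N: "N \<in> lsec" "n + m \<in> N" "N \<subseteq> ssum L M" "L \<noteq> N" "M \<noteq> N"
    using covered_sum[OF L n(2) m(2) nz(1,2) cov(1)] by metis
  obtain K where K: "K \<in> lsec" "c *s n + m' \<in> K" "K \<subseteq> ssum L M" "L \<noteq> K" "M \<noteq> K"
    using covered_sum[OF L cn(1) m(4) cn(2) nz(3) cov(2)] by metis
  have sN: "vec.subspace N" and sK: "vec.subspace K" using N K lsec_subspace by auto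
  note addN = vec.subspace_add[OF sN] and addK = vec.subspace_add[OF sK]
    and scaleN = vec.subspace_scale[OF sN] and scaleK = vec.subspace_scale[OF sK]
  note gN = graph_U[OF L(1,2) N(1) L(3) N(4,5,3)] and gK = graph_U[OF L(1,2) K(1) L(3) K(4,5,3)]
  have N': "N \<subseteq> ssum M L" and K': "K \<subseteq> ssum M L" using N K by (auto simp: ssum_commute)
  note gN' = graph_U[OF L(2,1) N(1) L(3)[symmetric] N(5,4) N']
    and gK' = graph_U[OF L(2,1) K(1) L(3)[symmetric] K(5,4) K']
  obtain n' where n': "hole n'" "n' \<in> L" "n' \<notin> vec.span {n}" using holes_of_line[OF L(1) n] by metis
  have n'0: "n' \<noteq> 0" using n' hole_nonzero by auto
  have L_eq: "L = vec.span {n, n'}"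
    using proj_line_eq_span[OF lsec_line[OF L(1)] n(2) n'(2) nz(1) n'(3)] .
  \<comment> \<open>\<open>N\<close> matches \<open>n\<close> with \<open>m\<close>, so it must
    match \<open>n'\<close> with the other hole of \<open>M\<close>; otherwise a combination of
    \<open>n\<close> and \<open>n'\<close> would lie in \<open>L \<inter> N\<close>. Likewise
    \<open>K\<close> matches \<open>n'\<close> with a multiple of \<open>m\<close>.\<close>
  obtain a where a: "a \<noteq> 0" "n' + a *s m' \<in> N"
  proof -
    obtain y where y: "y \<in> M" "n' + y \<in> N" using graph_ex[OF L(1,2) N(1) L(3) N(4,5,3) n'(2)] .
    have hy: "hole y" using graph_hole(1)[OF L(1,2) N(1) L(3) N(4,5,3) n'(2) y n'(1)] .
    have "y \<notin> vec.span {m}"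
    proof
      assume "y \<in> vec.span {m}"
      then obtain b where b: "y = b *s m" by (auto simp: in_span_singleton)
      have "(n' + y) - b *s (n + m) \<in> N" using y N by (intro vec.subspace_diff[OF sN] scaleN)
      then have "n' - b *s n \<in> N" by (simp add: b vec.scale_right_distrib)
      moreover have "n' - b *s n \<in> L" using n n' by (intro vec.subspace_diff[OF sL] vec.subspace_scale[OF sL])
      ultimately have "n' - b *s n = 0" using lsec_Int[OF L(1) N(1,4)] by blast
      then show False using n'(3) by (auto simp: in_span_singleton)
    qed
    then have "y \<in> vec.span {m'}" using two_holes[OF L(2) m m'm hy y(1)] by blast
    then obtain a where a: "y = a *s m'" by (auto simp: in_span_singleton)
    then have "a \<noteq> 0" using hole_nonzero[OF hy] by auto
    then show ?thesis using that a y by blast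
  qed
  obtain b where b: "b \<noteq> 0" "n' + b *s m \<in> K"
  proof -
    obtain y where y: "y \<in> M" "n' + y \<in> K" using graph_ex[OF L(1,2) K(1) L(3) K(4,5,3) n'(2)] .
    have hy: "hole y" using graph_hole(1)[OF L(1,2) K(1) L(3) K(4,5,3) n'(2) y n'(1)] .
    have "y \<notin> vec.span {m'}"
    proof
      assume "y \<in> vec.span {m'}"
      then obtain b where b: "y = b *s m'" by (auto simp: in_span_singleton)
      have "(n' + y) - b *s (c *s n + m') \<in> K" using y K by (intro vec.subspace_diff[OF sK] scaleK)
      then have "n' - (b * c) *s n \<in> K" by (simp add: b vec.scale_right_distrib)
      moreover have "n' - (b * c) *s n \<in> L" using n n' by (intro vec.subspace_diff[OF sL] vec.subspace_scale[OF sL])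
      ultimately have "n' - (b * c) *s n = 0" using lsec_Int[OF L(1) K(1,4)] by blast
      then show False using n'(3) by (auto simp: in_span_singleton)
    qed
    then have "y \<in> vec.span {m}" using two_holes[OF L(2) m m'm hy y(1)] by blast
    then obtain b where b: "y = b *s m" by (auto simp: in_span_singleton)
    then have "b \<noteq> 0" using hole_nonzero[OF hy] by auto
    then show ?thesis using that b y by blast
  qed
  obtain u where u: "u \<in> U" "u \<in> L" "u \<noteq> 0" using lsec_ex_U[OF L(1)] .
  obtain s t where st: "u = s *s n + t *s n'"
  proof -
    have "u \<in> vec.span (insert n {n'})" using u(2) L_eq by simp
    then obtain s where "u - s *s n \<in> vec.span {n'}" unfolding vec.span_breakdown_eq ..
    then obtain t where "u - s *s n = t *s n'" by (auto simp: in_span_singleton)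
    then have "u = s *s n + t *s n'" by (simp add: algebra_simps)
    then show ?thesis using that by blast
  qed
  \<comment> \<open>A chain of matched vectors: \<open>N\<close> matches \<open>u\<close> with
    \<open>v\<close> and \<open>u'\<close> with \<open>v'\<close>, while \<open>K\<close> matches
    \<open>u'\<close> with \<open>v\<close> and \<open>u\<close> with \<open>w\<close>. So
    \<open>u'\<close> is the image of \<open>u\<close> under the map \<open>g\<close>, and all five
    vectors lie in \<open>U\<close>.\<close>
  define v where "v = s *s m + (t * a) *s m'"
  define u' where "u' = (c * a * t) *s n + (s / b) *s n'"
  define v' where "v' = (c * a * t) *s m + (a * s / b) *s m'"
  define w where "w = (s / c) *s m' + (b * t) *s m"
  have inM: "v \<in> M" "v' \<in> M" "w \<in> M" unfolding v_def v'_def w_def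
    using m by (auto intro!: vec.subspace_add[OF sM] vec.subspace_scale[OF sM])
  have inL: "u' \<in> L" unfolding u'_def
    using n n' by (auto intro!: vec.subspace_add[OF sL] vec.subspace_scale[OF sL])
  have "s *s (n + m) + t *s (n' + a *s m') \<in> N" by (rule addN[OF scaleN[OF N(2)] scaleN[OF a(2)]])
  then have uv: "u + v \<in> N" by (simp add: st v_def vec.scale_right_distrib add_ac)
  have "(a * t) *s (c *s n + m') + (s / b) *s (n' + b *s m) \<in> K" by (rule addK[OF scaleK[OF K(2)] scaleK[OF b(2)]])
  then have u'v: "u' + v \<in> K" using b(1) by (simp add: u'_def v_def vec.scale_right_distrib add_ac mult_ac)
  have "(c * a * t) *s (n + m) + (s / b) *s (n' + a *s m') \<in> N" by (rule addN[OF scaleN[OF N(2)] scaleN[OF a(2)]])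
  then have u'v': "u' + v' \<in> N" by (simp add: u'_def v'_def vec.scale_right_distrib add_ac mult_ac)
  have "(s / c) *s (c *s n + m') + t *s (n' + b *s m) \<in> K" by (rule addK[OF scaleK[OF K(2)] scaleK[OF b(2)]])
  then have uw: "u + w \<in> K" using c by (simp add: st w_def vec.scale_right_distrib add_ac mult_ac)
  have vU: "v \<in> U" by (rule gN(1)[OF u(2) inM(1) uv u(1)])
  have u'U: "u' \<in> U" using gK'(1)[OF inM(1) inL _ vU] u'v by (simp add: add.commute)
  have v'U: "v' \<in> U" by (rule gN(1)[OF inL inM(2) u'v' u'U])
  have wU: "w \<in> U" by (rule gK(1)[OF u(2) inM(3) uw u(1)])
  have "w \<noteq> 0" using uw u lsec_eq[OF L(1) K(1), of u] K(4) by auto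
  have v'w: "v' = (c * a / b) *s w"
    using b c by (simp add: v'_def w_def vec.scale_right_distrib add_ac mult_ac)
  have "c * a / b = 1"
    using scattered[OF wU \<open>w \<noteq> 0\<close>, of "c * a / b"] v'U v'w a b c by auto
  then have "v' = w" using v'w by simp
  \<comment> \<open>\<open>v' = w\<close> says that \<open>g\<close> takes \<open>u'\<close> back to
    \<open>u\<close>. Hence \<open>u - u'\<close> is fixed, and if it vanishes \<open>u\<close>
    itself is; either way \<open>N\<close> and \<open>K\<close> share a nonzero vector.\<close>
  have "(u + v) - (u' + v') \<in> N" using uv u'v' by (intro vec.subspace_diff[OF sN])
  moreover have "(u + w) - (u' + v) \<in> K" using uw u'v by (intro vec.subspace_diff[OF sK])
  moreover have "(u + v) - (u' + v') = (u - u') + (v - v')" "(u + w) - (u' + v) = (u - u') + (v - v')"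
    using \<open>v' = w\<close> by (simp_all add: algebra_simps vdiff_eq)
  ultimately have both: "(u - u') + (v - v') \<in> N" "(u - u') + (v - v') \<in> K" by simp_all
  have "N = K"
  proof (cases "u = u'")
    case True
    have "u + v \<in> K" using u'v True by simp
    moreover have "u + v \<noteq> 0" using lsec_sum_nonzero[OF L u(2) inM(1) u(3)] .
    ultimately show ?thesis using lsec_eq[OF N(1) K(1) uv] by blast
  next
    case False
    have "(u - u') + (v - v') \<noteq> 0"
      using u inL inM False
      by (intro lsec_sum_nonzero[OF L] vec.subspace_diff[OF sL] vec.subspace_diff[OF sM]) auto
    then show ?thesis using lsec_eq[OF N(1) K(1)] both by blast
  qed
  then have "(c *s n + m') - c *s (n + m) \<in> N" using N K by (intro vec.subspace_diff[OF sN] scaleN) auto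
  then have "m' - c *s m \<in> N" by (simp add: vec.scale_right_distrib)
  moreover have "m' - c *s m \<in> M" using m by (intro vec.subspace_diff[OF sM] vec.subspace_scale[OF sM])
  ultimately have "m' - c *s m = 0" using lsec_Int[OF L(2) N(1,5)] by blast
  then show False using m'm by (auto simp: in_span_singleton)
qed

text \<open>For a fixed \<open>u \<in> U \<inter> L\<close>, the secants through
  \<open>u + v\<close> with nonzero \<open>v \<in> U \<inter> M\<close> match \<open>n\<close> with
  holes \<open>Y v\<close> of \<open>M\<close>. By \<open>no_swap\<close> all of them belong to one
  point, that of \<open>m\<close>. Distinct \<open>v\<close> give distinct \<open>Y v\<close>, so
  these \<open>q - 1\<close> values are all nonzero multiples of \<open>m\<close>, which makes every
  combination of \<open>n\<close> and \<open>m\<close> a hole.\<close>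

lemma matching_hole:
  assumes L: "L \<in> lsec" "M \<in> lsec" "L \<noteq> M" and n: "hole n" "n \<in> L"
  obtains m where "hole m" "m \<in> M"
    "\<And>c d. c \<noteq> 0 \<or> d \<noteq> 0 \<Longrightarrow> hole (c *s n + d *s m)"
    "\<And>c y. c \<noteq> 0 \<Longrightarrow> hole y \<Longrightarrow> y \<in> M \<Longrightarrow> c *s n + y \<in> \<Union>lsec \<Longrightarrow> y \<in> vec.span {m}"
proof -
  obtain u where u: "u \<in> U" "u \<in> L" "u \<noteq> 0" using lsec_ex_U[OF L(1)] .
  have n0: "n \<noteq> 0" using n hole_nonzero by simp
  have "\<forall>v\<in>U \<inter> M - {0}. \<exists>y N. N \<in> lsec \<and> u + v \<in> N \<and> N \<subseteq> ssum L M \<and> L \<noteq> N \<and> M \<noteq> N \<and> y \<in> M \<and> n + y \<in> N"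
  proof
    fix v assume v: "v \<in> U \<inter> M - {0}"
    have nz: "u + v \<noteq> 0" using lsec_sum_nonzero[OF L u(2)] v u(3) by auto
    obtain N0 where "N0 \<in> lsec" "u + v \<in> N0" using secant_through_sum[OF L u(1,2), of v] v nz by blast
    then have "u + v \<in> \<Union>lsec" by auto
    then obtain N where N: "N \<in> lsec" "u + v \<in> N" "N \<subseteq> ssum L M" "L \<noteq> N" "M \<noteq> N"
      using covered_sum[OF L u(2) _ u(3)] v by blast
    obtain y where "y \<in> M" "n + y \<in> N" using graph_ex[OF L(1,2) N(1) L(3) N(4,5,3) n(2)] .
    then show "\<exists>y N. N \<in> lsec \<and> u + v \<in> N \<and> N \<subseteq> ssum L M \<and> L \<noteq> N \<and> M \<noteq> N \<and> y \<in> M \<and> n + y \<in> N"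
      using N by blast
  qed
  then obtain Y where "\<forall>v\<in>U \<inter> M - {0}. \<exists>N. N \<in> lsec \<and> u + v \<in> N \<and> N \<subseteq> ssum L M \<and> L \<noteq> N \<and> M \<noteq> N \<and> Y v \<in> M \<and> n + Y v \<in> N"
    by metis
  then obtain F where F: "\<And>v. v \<in> U \<inter> M - {0} \<Longrightarrow> F v \<in> lsec \<and> u + v \<in> F v \<and> F v \<subseteq> ssum L M \<and> L \<noteq> F v \<and> M \<noteq> F v \<and> Y v \<in> M \<and> n + Y v \<in> F v"
    by metis
  have hY: "hole (Y v)" if v: "v \<in> U \<inter> M - {0}" for v
    using graph_hole(1)[OF L(1,2) _ L(3)] F[OF v] n by blast
  have covY: "n + Y v \<in> \<Union>lsec" if v: "v \<in> U \<inter> M - {0}" for v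
    using F[OF v] by auto
  obtain v0 where v0: "v0 \<in> U \<inter> M - {0}" using lsec_ex_U[OF L(2)] by blast
  define m where "m = Y v0"
  have m: "hole m" "m \<in> M" using hY[OF v0] F[OF v0] by (auto simp: m_def)
  have uniq: "y \<in> vec.span {m}"
    if "c \<noteq> 0" "hole y" "y \<in> M" "c *s n + y \<in> \<Union>lsec" for c y
    using no_swap[OF L n m that(2,3,1) _ that(4)] covY[OF v0] by (simp add: m_def)
  have "inj_on Y (U \<inter> M - {0})"
  proof (rule inj_onI)
    fix v v' assume v: "v \<in> U \<inter> M - {0}" "v' \<in> U \<inter> M - {0}" and eq: "Y v = Y v'"
    have "n + Y v \<noteq> 0" using lsec_sum_nonzero[OF L n(2) _ n0] F[OF v(1)] by blast
    then have "F v = F v'" using lsec_eq[of "F v" "F v'" "n + Y v"] F[OF v(1)] F[OF v(2)] eq by simp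
    then have "(u + v) - (u + v') \<in> F v"
      using F[OF v(1)] F[OF v(2)] vec.subspace_diff[OF lsec_subspace] by metis
    then have "v - v' \<in> F v" by simp
    moreover have "v - v' \<in> M" using v vec.subspace_diff[OF lsec_subspace[OF L(2)]] by blast
    ultimately have "v - v' = 0" using lsec_Int[of M "F v"] L F[OF v(1)] by blast
    then show "v = v'" by simp
  qed
  then have "card (Y ` (U \<inter> M - {0})) = card (vec.span {m} - {0})"
    using card_U_minus_zero[OF L(2)] card_span_minus_zero[OF hole_nonzero[OF m(1)]] by (simp add: card_image)
  moreover have "Y ` (U \<inter> M - {0}) \<subseteq> vec.span {m} - {0}"
  proof
    fix y assume "y \<in> Y ` (U \<inter> M - {0})"
    then obtain v where v: "v \<in> U \<inter> M - {0}" "y = Y v" by auto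
    then show "y \<in> vec.span {m} - {0}"
      using uniq[of 1 y] hY[OF v(1)] covY[OF v(1)] F[OF v(1)] hole_nonzero by simp
  qed
  ultimately have Yim: "Y ` (U \<inter> M - {0}) = vec.span {m} - {0}" by (intro card_subset_eq) auto
  have hol1: "hole (n + y)" if "y \<in> vec.span {m}" "y \<noteq> 0" for y
  proof -
    have "y \<in> Y ` (U \<inter> M - {0})" using that Yim by simp
    then obtain v where v: "v \<in> U \<inter> M - {0}" "y = Y v" by auto
    then show ?thesis using graph_hole(2)[OF L(1,2) _ L(3)] F[OF v(1)] n by blast
  qed
  have hol: "hole (c *s n + d *s m)" if cd: "c \<noteq> 0 \<or> d \<noteq> 0" for c d
  proof (cases "c = 0 \<or> d = 0")
    case True
    then show ?thesis using cd hole_scale n m by auto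
  next
    case False
    then have "hole (n + (d / c) *s m)"
      using hole_nonzero[OF m(1)] by (intro hol1) (auto simp: in_span_singleton)
    then have "hole (c *s (n + (d / c) *s m))" using False by (intro hole_scale) auto
    then show ?thesis using False by (simp add: vec.scale_right_distrib)
  qed
  show ?thesis
  proof (rule that[OF m])
    show "hole (c *s n + d *s m)" if "c \<noteq> 0 \<or> d \<noteq> 0" for c d by (rule hol[OF that])
    show "y \<in> vec.span {m}" if "c \<noteq> 0" "hole y" "y \<in> M" "c *s n + y \<in> \<Union>lsec" for c y
      by (rule uniq[OF that])
  qed
qed

section \<open>Adjacency of holes and its transitivity\<close>

text \<open>Holes related in this way will form a transversal space. The alternative
  \<open>r + s = 0\<close>, that is \<open>r = s\<close>, makes the relation reflexive.\<close>

definition adj :: "'a ^ 'n \<Rightarrow> 'a ^ 'n \<Rightarrow> bool" where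
  "adj r s \<longleftrightarrow> r + s = 0 \<or> hole (r + s)"

lemma adj_commute: "adj r s \<longleftrightarrow> adj s r"
  by (simp add: adj_def add.commute)

lemma add_add_self: "x + y + y = (x :: 'a ^ 'n)" "y + (x + y) = x"
  by (simp_all only: add.assoc add.left_commute[of y x] vadd_self add_0_right)

lemma hole_covered: "hole e \<Longrightarrow> e \<in> \<Union>lsec"
  by (simp add: hole_def)

lemma span_singleton_trans:
  fixes x y z :: "'a ^ 'n"
  assumes "x \<in> vec.span {z}" "y \<in> vec.span {z}" "x \<noteq> 0"
  shows "y \<in> vec.span {x}"
  using span_singleton_eq[OF assms(1,3)] assms(2) by simp

lemma adj_span:
  assumes "hole r" "s \<in> vec.span {r}"
  shows "adj r s"
proof -
  have "r + s \<in> vec.span {r}" using assms by (intro vec.span_add) (auto intro: vec.span_base)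
  then show ?thesis using hole_span[OF assms(1)] by (auto simp: adj_def)
qed

text \<open>A sum of vectors from the two different hole points of \<open>L\<close> lies in neither
  point.\<close>

lemma adj_same_line:
  assumes L: "L \<in> lsec" and r: "hole r" "r \<in> L" and s: "hole s" "s \<in> L" and rs: "adj r s"
  shows "s \<in> vec.span {r}"
proof (rule ccontr)
  assume n: "s \<notin> vec.span {r}"
  have r0: "r \<in> vec.span {r}" and s0: "s \<in> vec.span {s}" by (auto intro: vec.span_base)
  have "r + s \<in> L" using r s by (intro vec.subspace_add[OF lsec_subspace[OF L]])
  then have "r + s = 0 \<or> r + s \<in> vec.span {r} \<or> r + s \<in> vec.span {s}"
    using two_holes[OF L r s n] rs by (auto simp: adj_def)
  then have "r + s \<in> vec.span {r} \<or> r + s \<in> vec.span {s}" using vec.span_zero by metis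
  then show False
  proof
    assume "r + s \<in> vec.span {r}"
    from vec.span_diff[OF this r0] show False using n by simp
  next
    assume "r + s \<in> vec.span {s}"
    from vec.span_diff[OF this s0] have "r \<in> vec.span {s}" by simp
    then show False using span_singleton_trans[OF _ s0] n hole_nonzero[OF r(1)] by blast
  qed
qed

lemma adj_hole:
  assumes "L \<in> lsec" "M \<in> lsec" "L \<noteq> M" "r \<in> L" "s \<in> M" "hole r" "adj r s"
  shows "hole (r + s)"
  using assms lsec_sum_nonzero hole_nonzero by (auto simp: adj_def)

text \<open>The hole point of \<open>M\<close> matched with \<open>r\<close> is unique, so
  \<open>s\<close> can replace the \<open>m\<close> of \<open>matching_hole\<close>.\<close>

lemma hole_combination:
  assumes L: "L \<in> lsec" "M \<in> lsec" "L \<noteq> M" and r: "hole r" "r \<in> L" and s: "hole s" "s \<in> M"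
    and rs: "adj r s" and cd: "c \<noteq> 0 \<or> d \<noteq> 0"
  shows "hole (c *s r + d *s s)"
proof -
  obtain m where m: "\<And>c d. c \<noteq> 0 \<or> d \<noteq> 0 \<Longrightarrow> hole (c *s r + d *s m)"
    "\<And>c y. c \<noteq> 0 \<Longrightarrow> hole y \<Longrightarrow> y \<in> M \<Longrightarrow> c *s r + y \<in> \<Union>lsec \<Longrightarrow> y \<in> vec.span {m}"
    using matching_hole[OF L r] by metis
  have "s \<in> vec.span {m}"
    using m(2)[of 1 s] s hole_covered[OF adj_hole[OF L r(2) s(2) r(1) rs]] by simp
  then obtain e where e: "s = e *s m" by (auto simp: in_span_singleton)
  then have "e \<noteq> 0" using hole_nonzero[OF s(1)] by auto
  then show ?thesis using m(1)[of c "d * e"] cd e by simp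
qed

lemma matching_unique:
  assumes L: "L \<in> lsec" "M \<in> lsec" "L \<noteq> M" and n: "hole n" "n \<in> L"
    and y: "hole y" "y \<in> M" "c \<noteq> 0" "c *s n + y \<in> \<Union>lsec"
    and z: "hole z" "z \<in> M" "d \<noteq> 0" "d *s n + z \<in> \<Union>lsec"
  shows "z \<in> vec.span {y}"
proof -
  obtain m where m:
    "\<And>c y. c \<noteq> 0 \<Longrightarrow> hole y \<Longrightarrow> y \<in> M \<Longrightarrow> c *s n + y \<in> \<Union>lsec \<Longrightarrow> y \<in> vec.span {m}"
    using matching_hole[OF L n] by metis
  show ?thesis
    using span_singleton_trans[OF m[OF y(3,1,2,4)] m[OF z(3,1,2,4)] hole_nonzero[OF y(1)]] .
qed

text \<open>As a graph, \<open>T\<close> contains \<open>r + s'\<close> for some hole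
  \<open>s'\<close>, a multiple of \<open>s\<close>. Both \<open>t\<close> and \<open>r + s'\<close>
  are matched with \<open>s\<close>, so \<open>t\<close> is a multiple of \<open>r + s'\<close>, and
  \<open>r + t\<close> is a combination of \<open>r\<close> and \<open>s\<close>.\<close>

lemma adj_trans_coplanar:
  assumes L: "R \<in> lsec" "S \<in> lsec" "T \<in> lsec" "R \<noteq> S" "R \<noteq> T" "S \<noteq> T"
    and r: "hole r" "r \<in> R" and s: "hole s" "s \<in> S" and t: "hole t" "t \<in> T"
    and adj: "adj r s" "adj s t" and sub: "T \<subseteq> ssum R S"
  shows "adj r t"
proof -
  obtain s' where s': "s' \<in> S" "r + s' \<in> T" using graph_ex[OF L sub r(2)] .
  have h: "hole s'" "hole (r + s')" using graph_hole[OF L sub r(2) s' r(1)] by auto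
  have "s' \<in> vec.span {s}"
    using matching_unique[OF L(1,2,4) r s, of 1 s' 1] h s' hole_covered
      adj_hole[OF L(1,2,4) r(2) s(2) r(1) adj(1)] by simp
  then obtain c where c: "s' = c *s s" by (auto simp: in_span_singleton)
  have c0: "c \<noteq> 0" using c hole_nonzero[OF h(1)] by auto
  \<comment> \<open>In characteristic 2, adding \<open>s'\<close> once more returns
    \<open>r\<close>, which lies on a long secant; so \<open>r + s'\<close> is matched with
    \<open>s\<close>.\<close>
  have "c *s s + (r + s') = r" by (simp only: add_add_self flip: c)
  then have cov: "c *s s + (r + s') \<in> \<Union>lsec" using hole_covered[OF r(1)] by (simp only:)
  have "t \<in> vec.span {r + s'}"
    using matching_unique[OF L(2,3,6) s h(2) s'(2) c0 cov t one_neq_zero]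
      hole_covered[OF adj_hole[OF L(2,3,6) s(2) t(2) s(1) adj(2)]] by simp
  then obtain d where "t = d *s (r + s')" by (auto simp: in_span_singleton)
  then have rt: "r + t = (1 + d) *s r + (d * c) *s s"
    by (simp add: c vec.scale_right_distrib vec.scale_left_distrib)
  show ?thesis
  proof (cases "1 + d = 0 \<and> d * c = 0")
    case True
    then show ?thesis by (simp add: adj_def rt)
  next
    case False
    then have "hole (r + t)"
      unfolding rt using hole_combination[OF L(1,2,4) r s adj(1)] by blast
    then show ?thesis by (simp add: adj_def)
  qed
qed

text \<open>
  The secant through \<open>u + v + w\<close>, with \<open>u\<close>, \<open>v\<close>, \<open>w\<close> in \<open>U\<close> matched like \<open>r\<close>, \<open>s\<close>, \<open>t\<close>, contains
  \<open>r + s + t\<close>; splitting off \<open>s\<close> shows that \<open>r + t\<close> lies on the secant through \<open>u + w\<close>.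
\<close>

lemma adj_trans_independent:
  assumes L: "R \<in> lsec" "S \<in> lsec" "T \<in> lsec" "R \<noteq> S" "R \<noteq> T" "S \<noteq> T"
    and r: "hole r" "r \<in> R" and s: "hole s" "s \<in> S" and t: "hole t" "t \<in> T"
    and adj: "adj r s" "adj s t" and ind: "\<not> T \<subseteq> ssum R S"
  shows "adj r t"
proof -
  have sub: "vec.subspace R" "vec.subspace S" "vec.subspace T" using L lsec_subspace by auto
  have S_ind: "\<not> S \<subseteq> ssum R T" using ssum_exchange[OF L(1,3,2,5,4)] L(6) ind by auto
  have R_ind: "\<not> R \<subseteq> ssum S T"
    using ssum_exchange[OF L(2,3,1) L(6) L(4)[symmetric] L(5)[symmetric]] ind
    by (auto simp: ssum_commute)
  have nz: "r \<noteq> 0" "s \<noteq> 0" "t \<noteq> 0" using r s t hole_nonzero by auto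
  \<comment> \<open>\<open>L4\<close> passes through \<open>r + s\<close> and \<open>u + v\<close>,
    \<open>L5\<close> through \<open>s + t\<close> and \<open>v + w\<close>, \<open>L7\<close>
    through \<open>u + w\<close>, and \<open>L6\<close> through \<open>u + v + w\<close>.\<close>
  obtain L4 where L4: "L4 \<in> lsec" "r + s \<in> L4" "L4 \<subseteq> ssum R S" "R \<noteq> L4" "S \<noteq> L4"
    using covered_sum[OF L(1,2,4) r(2) s(2) nz(1,2)]
      hole_covered[OF adj_hole[OF L(1,2,4) r(2) s(2) r(1) adj(1)]] by metis
  obtain L5 where L5: "L5 \<in> lsec" "s + t \<in> L5" "L5 \<subseteq> ssum S T" "S \<noteq> L5" "T \<noteq> L5"
    using covered_sum[OF L(2,3,6) s(2) t(2) nz(2,3)]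
      hole_covered[OF adj_hole[OF L(2,3,6) s(2) t(2) s(1) adj(2)]] by metis
  have ne: "L4 \<noteq> T" "L5 \<noteq> R" using L4 L5 ind R_ind by auto
  obtain u where u: "u \<in> U" "u \<in> R" "u \<noteq> 0" using lsec_ex_U[OF L(1)] .
  obtain v where v: "v \<in> S" "u + v \<in> L4" using graph_ex[OF L(1,2) L4(1) L(4) L4(4,5,3) u(2)] .
  have vU: "v \<in> U" "u + v \<in> U" using graph_U[OF L(1,2) L4(1) L(4) L4(4,5,3) u(2) v u(1)] by auto
  have v0: "v \<noteq> 0" using lsec_eq[OF L(1) L4(1), of u] u v L4(4) by auto
  obtain w where w: "w \<in> T" "v + w \<in> L5" using graph_ex[OF L(2,3) L5(1) L(6) L5(4,5,3) v(1)] .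
  have wU: "w \<in> U" "v + w \<in> U" using graph_U[OF L(2,3) L5(1) L(6) L5(4,5,3) v(1) w vU(1)] by auto
  have w0: "w \<noteq> 0" using lsec_eq[OF L(2) L5(1), of v] v0 v w L5(4) by auto
  have uv0: "u + v \<noteq> 0" using lsec_sum_nonzero[OF L(1,2,4) u(2) v(1) u(3)] .
  have uw0: "u + w \<noteq> 0" using lsec_sum_nonzero[OF L(1,3,5) u(2) w(1) u(3)] .
  have uwU: "u + w \<in> U" using u wU by (intro add_U)
  obtain L7 where L7: "L7 \<in> lsec" "u + w \<in> L7" "L7 \<subseteq> ssum R T"
    using secant_through_sum[OF L(1,3,5) u(1,2) wU(1) w(1) uw0] .
  have SL7: "S \<noteq> L7" using L7 S_ind by auto
  have sum0: "(u + v) + w \<noteq> 0" using lsec_sum_nonzero[OF L4(1) L(3) ne(1) v(2) w(1) uv0] .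
  obtain L6 where L6: "L6 \<in> lsec" "(u + v) + w \<in> L6" "L6 \<subseteq> ssum L4 T"
    using secant_through_sum[OF L4(1) L(3) ne(1) vU(2) v(2) wU(1) w(1) sum0] .
  \<comment> \<open>The three ways to bracket \<open>u + v + w\<close> give one and the same secant,
    which therefore lies in \<open>ssum L4 T\<close>, in \<open>ssum R L5\<close> and in
    \<open>ssum S L7\<close>.\<close>
  have "u + (v + w) \<noteq> 0" using sum0 by (simp add: add.assoc)
  then obtain L6' where L6': "L6' \<in> lsec" "u + (v + w) \<in> L6'" "L6' \<subseteq> ssum R L5"
    using secant_through_sum[OF L(1) L5(1) ne(2)[symmetric] u(1,2) wU(2) w(2)] by metis
  have "L6' = L6" using lsec_eq[OF L6'(1) L6(1) L6'(2)] L6(2) sum0 by (simp add: add.assoc)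
  have "v + (u + w) \<noteq> 0" using sum0 by (simp add: add_ac)
  then obtain L6'' where L6'': "L6'' \<in> lsec" "v + (u + w) \<in> L6''" "L6'' \<subseteq> ssum S L7"
    using secant_through_sum[OF L(2) L7(1) SL7 vU(1) v(1) uwU L7(2)] by metis
  have "L6'' = L6" using lsec_eq[OF L6''(1) L6(1) L6''(2)] L6(2) sum0 by (simp add: add_ac)
  have s6: "vec.subspace L6" using L6 lsec_subspace by auto
  have RT: "vec.subspace (ssum R T)" using sub by (intro subspace_ssum)
  have S_RT: "x = 0" if "x \<in> S" "x \<in> ssum R T" for x
    using lsec_subset_ssum[OF L(1,3,5,2) that] S_ind by blast
  have L6_RT: "x = 0" if "x \<in> L6" "x \<in> ssum R T" for x
  proof (rule ccontr)
    assume "x \<noteq> 0"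
    then have "L6 \<subseteq> ssum R T" using lsec_subset_ssum[OF L(1,3,5) L6(1) that] by simp
    then have "(u + v) + w \<in> ssum R T" using L6(2) by blast
    then have "((u + v) + w) - (u + w) \<in> ssum R T"
      by (rule vec.subspace_diff[OF RT _ ssumI[OF u(2) w(1)]])
    then have "v \<in> ssum R T" by (simp add: algebra_simps)
    then show False using S_RT[OF v(1)] v0 by simp
  qed
  have L46: "L4 \<noteq> L6"
  proof
    assume "L4 = L6"
    then have "((u + v) + w) - (u + v) \<in> L4"
      using L6(2) v(2) vec.subspace_diff[OF lsec_subspace[OF L4(1)]] by blast
    then show False using lsec_eq[OF L4(1) L(3), of w] w w0 ne by simp
  qed
  have TL6: "T \<noteq> L6"
  proof
    assume "T = L6"
    then have "((u + v) + w) - w \<in> T"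
      using L6(2) w(1) vec.subspace_diff[OF sub(3)] by blast
    then show False using lsec_eq[OF L4(1) L(3) v(2)] uv0 ne by simp
  qed
  have RL6: "R \<noteq> L6"
  proof
    assume "R = L6"
    then have "(u + (v + w)) - u \<in> R"
      using L6(2) u(2) vec.subspace_diff[OF sub(1)] by (metis add.assoc)
    moreover have "v + w \<noteq> 0" using lsec_sum_nonzero[OF L(2,3,6) v(1) w(1) v0] .
    ultimately show False using lsec_eq[OF L5(1) L(1) w(2)] ne by simp
  qed
  have L56: "L5 \<noteq> L6"
  proof
    assume "L5 = L6"
    then have "(u + (v + w)) - (v + w) \<in> L5"
      using L6(2) w(2) vec.subspace_diff[OF lsec_subspace[OF L5(1)]] by (metis add.assoc)
    then show False using lsec_eq[OF L5(1) L(1), of u] u ne by simp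
  qed
  \<comment> \<open>\<open>L6\<close> as a graph over \<open>L4\<close> and over \<open>L5\<close>
    yields two of its vectors with the same component \<open>s\<close> in \<open>S\<close>. Their
    difference lies in \<open>ssum R T\<close>, which meets \<open>L6\<close> trivially, so
    \<open>z = t\<close>.\<close>
  obtain z where z: "z \<in> T" "(r + s) + z \<in> L6"
    using graph_ex[OF L4(1) L(3) L6(1) ne(1) L46 TL6 L6(3) L4(2)] .
  have "L6 \<subseteq> ssum L5 R" using L6'(3) \<open>L6' = L6\<close> by (simp add: ssum_commute)
  then obtain z' where z': "z' \<in> R" "(s + t) + z' \<in> L6"
    using graph_ex[OF L5(1) L(1) L6(1) ne(2) L56 RL6 _ L5(2)] by metis
  have "((r + s) + z) - ((s + t) + z') \<in> L6" using z z' by (intro vec.subspace_diff[OF s6])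
  moreover have "((r + s) + z) - ((s + t) + z') = (r - z') + (z - t)" by (simp add: algebra_simps)
  moreover have "(r - z') + (z - t) \<in> ssum R T"
    using r z' z t by (intro ssumI vec.subspace_diff sub) auto
  ultimately have "(r - z') + (z - t) = 0" using L6_RT by metis
  then have "r - z' = 0 \<and> z - t = 0"
    using lsec_direct[OF L(1,3,5), of "r - z'" 0 "z - t" 0] r z' z t sub
    by (simp add: vec.subspace_diff vec.subspace_0)
  then have "z = t" by simp
  \<comment> \<open>Splitting off the component \<open>s\<close> in \<open>S\<close> will leave
    \<open>r + t\<close> on \<open>L7\<close>.\<close>
  then have "(r + s) + t \<in> ssum S L7" using z(2) L6''(3) \<open>L6'' = L6\<close> by blast
  then obtain s1 p where sp: "s1 \<in> S" "p \<in> L7" "(r + s) + t = s1 + p" by (rule ssumE)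
  have "s1 - s = (r + t) - p" using sp(3) by (simp add: algebra_simps)
  moreover have "(r + t) - p \<in> ssum R T"
    using r t sp L7 by (intro vec.subspace_diff[OF RT] ssumI) auto
  moreover have "s1 - s \<in> S" using sp s by (intro vec.subspace_diff sub)
  ultimately have "(r + t) - p = 0" using S_RT by metis
  then have rt: "r + t \<in> L7" using sp by simp
  have "r + t \<in> \<Union>lsec" using rt L7 by auto
  then obtain N where N: "N \<in> lsec" "r + t \<in> N" "N \<subseteq> ssum R T" "R \<noteq> N" "T \<noteq> N"
    using covered_sum[OF L(1,3,5) r(2) t(2) nz(1,3)] by metis
  have "hole (r + t)" using graph_hole(2)[OF L(1,3) N(1) L(5) N(4,5,3) r(2) t(2) N(2) r(1)] .
  then show ?thesis by (simp add: adj_def)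
qed

lemma adj_trans:
  assumes r: "hole r" and s: "hole s" and t: "hole t" and adj: "adj r s" "adj s t"
  shows "adj r t"
proof -
  obtain R where R: "R \<in> lsec" "r \<in> R" using hole_line[OF r] .
  obtain S where S: "S \<in> lsec" "s \<in> S" using hole_line[OF s] .
  obtain T where T: "T \<in> lsec" "t \<in> T" using hole_line[OF t] .
  consider "R = S" "S = T" | "R = S" "S \<noteq> T" | "R \<noteq> S" "S = T" | "R = T" "R \<noteq> S"
    | "R \<noteq> S" "S \<noteq> T" "R \<noteq> T" by blast
  then show ?thesis
  proof cases
    case 1
    have "s \<in> vec.span {r}" using adj_same_line[OF R(1) r R(2) s _ adj(1)] S 1 by simp
    then have "vec.span {s} = vec.span {r}" using hole_nonzero[OF s] by (rule span_singleton_eq)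
    moreover have "t \<in> vec.span {s}" using adj_same_line[OF S(1) s S(2) t _ adj(2)] T 1 by simp
    ultimately show ?thesis using adj_span[OF r] by simp
  next
    case 2
    have "r \<in> vec.span {s}"
      using adj_same_line[OF S(1) s S(2) r] adj(1) R 2 adj_commute by simp
    then obtain c where c: "r = c *s s" by (auto simp: in_span_singleton)
    have "hole (c *s s + 1 *s t)" using S T s t adj 2 by (intro hole_combination[of S T]) auto
    then show ?thesis by (simp add: adj_def c)
  next
    case 3
    have "t \<in> vec.span {s}"
      using adj_same_line[OF S(1) s S(2) t] adj(2) T 3 by simp
    then obtain c where c: "t = c *s s" by (auto simp: in_span_singleton)
    have "hole (1 *s r + c *s s)" using R S r s adj 3 by (intro hole_combination[of R S]) auto
    then show ?thesis by (simp add: adj_def c)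
  next
    \<comment> \<open>Both \<open>r\<close> and \<open>t\<close> are holes of \<open>R\<close>
      matched with \<open>s\<close>, so they represent the same point.\<close>
    case 4
    have "hole (s + r)" using adj_hole[OF S(1) R(1) _ S(2) R(2) s] adj(1) 4 adj_commute by metis
    moreover have "hole (s + t)" using adj_hole[OF S(1) T(1) _ S(2) T(2) s adj(2)] 4 by metis
    ultimately have "t \<in> vec.span {r}"
      using matching_unique[OF S(1) R(1) _ s S(2) r R(2), of 1 t 1] t T 4 hole_covered by simp
    then show ?thesis by (rule adj_span[OF r])
  next
    case 5
    then show ?thesis
      using adj_trans_coplanar[OF R(1) S(1) T(1) 5(1,3,2) r R(2) s S(2) t T(2) adj]
        adj_trans_independent[OF R(1) S(1) T(1) 5(1,3,2) r R(2) s S(2) t T(2) adj] by blast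
  qed
qed

section \<open>Adjacency classes as subspaces\<close>

definition transversal :: "'a ^ 'n \<Rightarrow> ('a ^ 'n) set" where
  "transversal n = {t. (t = 0 \<or> hole t) \<and> adj n t}"

lemma transversal_subspace:
  assumes n: "hole n"
  shows "vec.subspace (transversal n)"
proof (rule vec.subspaceI)
  show "0 \<in> transversal n" using n by (simp add: transversal_def adj_def)
next
  fix s t assume s: "s \<in> transversal n" and t: "t \<in> transversal n"
  show "s + t \<in> transversal n"
  proof (cases "s = 0 \<or> t = 0 \<or> s + t = 0")
    case True
    moreover have "0 \<in> transversal n" using n by (simp add: transversal_def adj_def)
    ultimately show ?thesis using s t by auto
  next
    case False
    then have h: "hole s" "hole t" "adj n s" "adj n t" using s t by (auto simp: transversal_def)
    have "adj s t" using adj_trans[OF h(1) n h(2)] h adj_commute by blast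
    then have st: "hole (s + t)" using False by (simp add: adj_def)
    have "adj s (s + t)" using h(2) by (simp add: adj_def add_add_self add.commute[of s t])
    then show ?thesis using adj_trans[OF n h(1) st h(3)] st by (simp add: transversal_def)
  qed
next
  fix c t assume t: "t \<in> transversal n"
  show "c *s t \<in> transversal n"
  proof (cases "c = 0 \<or> t = 0")
    case True
    then show ?thesis using n by (auto simp: transversal_def adj_def)
  next
    case False
    then have h: "hole t" "adj n t" "hole (c *s t)" using t hole_scale by (auto simp: transversal_def)
    have "adj t (c *s t)" using h by (intro adj_span) (auto simp: in_span_singleton)
    then show ?thesis using adj_trans[OF n h(1,3,2)] h by (simp add: transversal_def)
  qed
qed

text \<open>On the secant of \<open>n\<close> the class consists of multiples of \<open>n\<close>;
  on any other secant it is the hole point supplied by \<open>matching_hole\<close>.\<close>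

lemma transversal_Int:
  assumes n: "hole n" and M: "M \<in> lsec"
  obtains m where "hole m" "transversal n \<inter> M = vec.span {m}"
proof -
  obtain L where L: "L \<in> lsec" "n \<in> L" using hole_line[OF n] .
  have sub: "vec.span {m} \<subseteq> transversal n \<inter> M" if "m \<in> M" "m \<in> transversal n" for m
    using that span_singleton_subset_iff[OF transversal_subspace[OF n]]
      span_singleton_subset_iff[OF lsec_subspace[OF M]] by blast
  show ?thesis
  proof (cases "L = M")
    case True
    have "n \<in> transversal n" using n by (simp add: transversal_def adj_def)
    then have "vec.span {n} \<subseteq> transversal n \<inter> M" using sub L True by simp
    moreover have "transversal n \<inter> M \<subseteq> vec.span {n}"
      using adj_same_line[OF L(1) n L(2)] True vec.span_zero by (auto simp: transversal_def)
    ultimately show ?thesis using that n by blast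
  next
    case False
    obtain m where m: "hole m" "m \<in> M" "\<And>c d. c \<noteq> 0 \<or> d \<noteq> 0 \<Longrightarrow> hole (c *s n + d *s m)"
      "\<And>c y. c \<noteq> 0 \<Longrightarrow> hole y \<Longrightarrow> y \<in> M \<Longrightarrow> c *s n + y \<in> \<Union>lsec \<Longrightarrow> y \<in> vec.span {m}"
      using matching_hole[OF L(1) M False n L(2)] by metis
    have "m \<in> transversal n" using m(1) m(3)[of 1 1] by (simp add: transversal_def adj_def)
    then have "vec.span {m} \<subseteq> transversal n \<inter> M" using sub m by simp
    moreover have "transversal n \<inter> M \<subseteq> vec.span {m}"
    proof
      fix t assume t: "t \<in> transversal n \<inter> M"
      show "t \<in> vec.span {m}"
      proof (cases "t = 0")
        case True
        then show ?thesis by (simp add: vec.span_zero)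
      next
        case False
        then have h: "hole t" "adj n t" using t by (auto simp: transversal_def)
        then have "hole (n + t)" using adj_hole[OF L(1) M \<open>L \<noteq> M\<close> L(2) _ n] t by blast
        then show ?thesis using m(4)[of 1 t] h t hole_covered by simp
      qed
    qed
    ultimately show ?thesis using that m by blast
  qed
qed

lemma sum_card_lsec:
  "card (X \<inter> \<Union>lsec - {0}) = (\<Sum>L\<in>lsec. card (X \<inter> L - {0}))"
proof -
  have "X \<inter> \<Union>lsec - {0} = (\<Union>L\<in>lsec. X \<inter> L - {0})" by auto
  also have "card \<dots> = (\<Sum>L\<in>lsec. card (X \<inter> L - {0}))"
    using lsec_Int by (intro card_UN_disjoint) auto
  finally show ?thesis .
qed

lemma vector_space_f2: "vector_space (f2_scale :: bit \<Rightarrow> 'a ^ 'n \<Rightarrow> 'a ^ 'n)"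
  by (rule vector_space_f2_scale[OF char2])

lemma f2_subspace_U: "f2_subspace U"
proof -
  interpret f2: vector_space "f2_scale :: bit \<Rightarrow> 'a ^ 'n \<Rightarrow> 'a ^ 'n" by (rule vector_space_f2)
  show ?thesis
    unfolding f2_subspace_def using zero_U add_U by (intro f2.subspaceI) (auto simp: f2_scale_def)
qed

lemma f2_dim_U:
  assumes "q = 2 ^ h"
  shows "f2_dim U = h * k"
proof -
  have "card U = 2 ^ f2_dim U"
    using card_subspace_dim[OF vector_space_f2 _ f2_subspace_U[unfolded f2_subspace_def]]
    by (simp add: f2_dim_def card_bit)
  then have "(2::nat) ^ f2_dim U = 2 ^ (h * k)" by (simp add: card_A assms power_mult)
  then show ?thesis by simp
qed

end

section \<open>Transversal spaces\<close>

text \<open>Dimension \<open>2 * k\<close> means \<open>card H = card U ^ 2\<close>, equality in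
  \<open>scattered_bound\<close>; so \<open>ex_secant\<close> applies to all of \<open>U\<close> and
  puts a long secant through each of its nonzero elements.\<close>

locale scattered_group_in_space = scattered_group U q k
  for U :: "('a::{field,finite} ^ 'n) set" and q k +
  fixes H :: "('a ^ 'n) set"
  assumes H: "vec.subspace H" "vec.dim H = 2 * k" "U \<subseteq> H"
begin

lemma U_covered: "U \<subseteq> \<Union>lsec \<union> {0}"
proof
  fix u assume u: "u \<in> U"
  have "card H \<le> card U ^ 2"
    using card_subspace[OF H(1)] by (simp add: H(2) card_A mult.commute[of 2] flip: power_mult)
  then show "u \<in> \<Union>lsec \<union> {0}"
    using ex_secant[OF order_refl H(3) diff_U H(1) _ u] by (cases "u = 0") auto
qed

text \<open>The long secants cut \<open>U - {0}\<close> into disjoint sets of \<open>q - 1\<close>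
  elements.\<close>

lemma card_lsec: "card lsec * (q - 1) = q ^ k - 1"
proof -
  have "U \<inter> \<Union>lsec - {0} = U - {0}" using U_covered by auto
  then have "card (U - {0}) = (\<Sum>L\<in>lsec. card (U \<inter> L - {0}))" using sum_card_lsec[of U] by simp
  also have "\<dots> = card lsec * (q - 1)" using card_U_minus_zero by simp
  finally show ?thesis using zero_U by (simp add: card_A card_Diff_singleton)
qed

lemma lsec_subset_H:
  assumes L: "L \<in> lsec" shows "L \<subseteq> H"
proof -
  obtain u where u: "u \<in> U" "u \<in> L" "u \<noteq> 0" using lsec_ex_U[OF L] .
  have "\<not> U \<inter> L \<subseteq> {0, u}"
  proof
    assume "U \<inter> L \<subseteq> {0, u}"
    then have "card (U \<inter> L) \<le> card {0, u}" by (intro card_mono) auto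
    then show False using lsec_card[OF L] q_ge u by simp
  qed
  then obtain v where v: "v \<in> U" "v \<in> L" "v \<noteq> 0" "v \<noteq> u" by auto
  then have "v \<notin> vec.span {u}" using span_U[OF u(1,3)] by blast
  then have "L = vec.span {u, v}" using proj_line_eq_span[OF lsec_line[OF L] u(2) v(2) u(3)] by blast
  moreover have "vec.span {u, v} \<subseteq> H" using u v H by (intro vec.span_minimal) auto
  ultimately show ?thesis by simp
qed

text \<open>The class has \<open>q - 1\<close> nonzero vectors on each long secant, just as
  \<open>U\<close> has, and none elsewhere.\<close>

lemma card_transversal:
  assumes n: "hole n" shows "card (transversal n) = q ^ k"
proof -
  have "transversal n \<inter> \<Union>lsec - {0} = transversal n - {0}"
    by (auto simp: transversal_def hole_def)
  then have "card (transversal n - {0}) = (\<Sum>L\<in>lsec. card (transversal n \<inter> L - {0}))"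
    using sum_card_lsec[of "transversal n"] by simp
  also have "\<dots> = (\<Sum>L\<in>lsec. q - 1)"
  proof (rule sum.cong)
    fix L assume "L \<in> lsec"
    then obtain m where "hole m" "transversal n \<inter> L = vec.span {m}" using transversal_Int[OF n] by metis
    then show "card (transversal n \<inter> L - {0}) = q - 1" using card_span_minus_zero hole_nonzero by simp
  qed simp
  also have "\<dots> = q ^ k - 1" using card_lsec by simp
  finally have "card (transversal n - {0}) = q ^ k - 1" .
  moreover have "card (transversal n) = Suc (card (transversal n - {0}))"
    using vec.subspace_0[OF transversal_subspace[OF n]] by (intro card.remove) auto
  ultimately show ?thesis using q_ge by simp
qed

text \<open>Vector form of membership in \<open>transversal_spaces\<close>; the two are identified
  in \<open>transversal_spaces_eq\<close>.\<close>

definition is_transversal :: "('a ^ 'n) set \<Rightarrow> bool" where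
  "is_transversal T \<longleftrightarrow> vec.subspace T \<and> vec.dim T = k \<and> T \<subseteq> H \<and> T \<inter> U \<subseteq> {0} \<and>
    (\<forall>L\<in>lsec. T \<inter> L \<noteq> {0})"

lemma is_transversal_transversal:
  assumes n: "hole n" shows "is_transversal (transversal n)"
  unfolding is_transversal_def
proof (intro conjI ballI)
  show s: "vec.subspace (transversal n)" by (rule transversal_subspace[OF n])
  have "q ^ vec.dim (transversal n) = q ^ k"
    using card_subspace[OF s] card_transversal[OF n] by simp
  then show "vec.dim (transversal n) = k" using q_ge by (simp add: power_inject_exp)
  have "transversal n \<subseteq> \<Union>lsec \<union> {0}" by (auto simp: transversal_def hole_def)
  then show "transversal n \<subseteq> H" using lsec_subset_H vec.subspace_0[OF H(1)] by blast
  show "transversal n \<inter> U \<subseteq> {0}"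
  proof
    fix t assume t: "t \<in> transversal n \<inter> U"
    then have "1 *s t \<in> U" by simp
    then have "\<not> hole t" unfolding hole_def by (metis zero_neq_one)
    then show "t \<in> {0}" using t by (auto simp: transversal_def)
  qed
  fix L assume "L \<in> lsec"
  then obtain m where m: "hole m" "transversal n \<inter> L = vec.span {m}" using transversal_Int[OF n] by metis
  then have "m \<in> transversal n \<inter> L" by (simp add: vec.span_base)
  then show "transversal n \<inter> L \<noteq> {0}" using hole_nonzero[OF m(1)] by blast
qed

text \<open>\<open>T\<close> has at least \<open>q - 1\<close> nonzero vectors on every long secant.
  By \<open>card_lsec\<close> these make up all \<open>q ^ k - 1\<close> nonzero vectors of
  \<open>T\<close>, so \<open>T\<close> is covered by long secants.\<close>

lemma is_transversal_hole:
  assumes T: "is_transversal T" and t: "t \<in> T" "t \<noteq> 0"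
  shows "hole t"
proof -
  have s: "vec.subspace T" and TU: "T \<inter> U \<subseteq> {0}" and TL: "\<And>L. L \<in> lsec \<Longrightarrow> T \<inter> L \<noteq> {0}"
    using T by (auto simp: is_transversal_def)
  have "card lsec * (q - 1) = (\<Sum>L\<in>lsec. q - 1)" by simp
  also have "\<dots> \<le> (\<Sum>L\<in>lsec. card (T \<inter> L - {0}))"
  proof (rule sum_mono)
    fix L assume L: "L \<in> lsec"
    have "0 \<in> T \<inter> L" using vec.subspace_0 s lsec_subspace[OF L] by auto
    then obtain x where x: "x \<in> T" "x \<in> L" "x \<noteq> 0" using TL[OF L] by auto
    then have "vec.span {x} \<subseteq> T \<inter> L" using s lsec_subspace[OF L] by (simp add: span_singleton_subset_iff)
    then have "card (vec.span {x} - {0}) \<le> card (T \<inter> L - {0})" by (intro card_mono) auto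
    then show "q - 1 \<le> card (T \<inter> L - {0})" using card_span_minus_zero[OF x(3)] by simp
  qed
  also have "\<dots> = card (T \<inter> \<Union>lsec - {0})" by (rule sum_card_lsec[symmetric])
  finally have "card (T - {0}) \<le> card (T \<inter> \<Union>lsec - {0})"
    using card_subspace[OF s] T card_lsec vec.subspace_0[OF s]
    by (simp add: is_transversal_def card_Diff_singleton)
  then have "T \<inter> \<Union>lsec - {0} = T - {0}" by (intro card_seteq) auto
  then have "t \<in> \<Union>lsec" using t by blast
  moreover have "c = 0" if "c *s t \<in> U" for c
    using that TU vec.subspace_scale[OF s t(1), of c] t(2) by auto
  ultimately show ?thesis using t by (simp add: hole_def)
qed

text \<open>Sums \<open>n + t\<close> stay in \<open>T\<close>, where every nonzero vector is a
  hole, so \<open>T\<close> lies in the class of \<open>n\<close>; both have \<open>q ^ k\<close>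
  elements.\<close>

lemma is_transversal_eq:
  assumes T: "is_transversal T" and n: "hole n" "n \<in> T"
  shows "T = transversal n"
proof (rule card_subset_eq)
  have s: "vec.subspace T" using T by (simp add: is_transversal_def)
  show "T \<subseteq> transversal n"
  proof
    fix t assume t: "t \<in> T"
    have "n + t \<in> T" by (rule vec.subspace_add[OF s n(2) t])
    then show "t \<in> transversal n" using is_transversal_hole[OF T] t by (auto simp: transversal_def adj_def)
  qed
  show "card T = card (transversal n)"
    using card_subspace[OF s] card_transversal[OF n(1)] T by (simp add: is_transversal_def)
qed simp

text \<open>A transversal space meets a fixed long secant in one of its two hole points, and a hole
  determines the space.\<close>

lemma card_is_transversal: "card {T. is_transversal T} = 2"
proof -
  have "card lsec \<noteq> 0"
  proof
    assume "card lsec = 0"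
    then have "q ^ k \<le> 1" using card_lsec by simp
    moreover have "q ^ 1 \<le> q ^ k" using q_ge k_ge by (intro power_increasing) auto
    ultimately show False using q_ge by simp
  qed
  then obtain L where L: "L \<in> lsec" by fastforce
  obtain n where n: "hole n" "n \<in> L" using ex_hole[OF L] .
  obtain n' where n': "hole n'" "n' \<in> L" "n' \<notin> vec.span {n}"
    "\<And>e. hole e \<Longrightarrow> e \<in> L \<Longrightarrow> e \<in> vec.span {n} \<or> e \<in> vec.span {n'}"
    using holes_of_line[OF L n] by metis
  have "{T. is_transversal T} = {transversal n, transversal n'}"
  proof
    show "{transversal n, transversal n'} \<subseteq> {T. is_transversal T}"
      using is_transversal_transversal n n' by auto
    show "{T. is_transversal T} \<subseteq> {transversal n, transversal n'}"
    proof
      fix T assume "T \<in> {T. is_transversal T}"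
      then have T: "is_transversal T" by simp
      have s: "vec.subspace T" using T by (simp add: is_transversal_def)
      have "0 \<in> T \<inter> L" using vec.subspace_0 s lsec_subspace[OF L] by auto
      moreover have "T \<inter> L \<noteq> {0}" using T L by (simp add: is_transversal_def)
      ultimately obtain x where x: "x \<in> T" "x \<in> L" "x \<noteq> 0" by blast
      have mem: "m \<in> T" if "hole m" "x \<in> vec.span {m}" for m
      proof -
        have "m \<in> vec.span {x}" using span_singleton_trans[OF that(2) _ x(3)] by (simp add: vec.span_base)
        then show ?thesis using span_singleton_subset_iff[OF s, of x] x by blast
      qed
      have "n \<in> T \<or> n' \<in> T" using n'(4)[OF is_transversal_hole[OF T x(1,3)] x(2)] mem n n' by blast
      then show "T \<in> {transversal n, transversal n'}" using is_transversal_eq[OF T] n n' by blast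
    qed
  qed
  moreover have "transversal n \<noteq> transversal n'"
  proof
    assume "transversal n = transversal n'"
    moreover have "n' \<in> transversal n'" using n' by (simp add: transversal_def adj_def)
    ultimately have "n' \<in> transversal n" by simp
    then have "adj n n'" by (simp add: transversal_def)
    then show False using adj_same_line[OF L n n'(1,2)] n'(3) by simp
  qed
  ultimately show ?thesis by simp
qed

section \<open>From vectors back to points\<close>

lemma points_of_Int_spanned_eq_empty_iff:
  assumes T: "vec.subspace T"
  shows "points_of T \<inter> points_spanned_by U = {} \<longleftrightarrow> T \<inter> U \<subseteq> {0}"
proof
  assume *: "points_of T \<inter> points_spanned_by U = {}"
  show "T \<inter> U \<subseteq> {0}"
  proof
    fix x assume x: "x \<in> T \<inter> U"
    have "vec.span {x} \<in> points_of T \<inter> points_spanned_by U" if "x \<noteq> 0"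
      using that x span_singleton_subset_iff[OF T] unfolding points_of_def points_spanned_by_def proj_point_iff
      by blast
    then show "x \<in> {0}" using * by blast
  qed
next
  assume *: "T \<inter> U \<subseteq> {0}"
  show "points_of T \<inter> points_spanned_by U = {}"
  proof (rule ccontr)
    assume "points_of T \<inter> points_spanned_by U \<noteq> {}"
    then obtain u where "u \<in> U" "u \<noteq> 0" "vec.span {u} \<subseteq> T"
      by (auto simp: points_of_def points_spanned_by_def)
    then show False using * vec.span_base[of u "{u}"] by blast
  qed
qed

lemma transversal_spaces_eq:
  "transversal_spaces H k (points_spanned_by U) lsec = {T. is_transversal T}"
proof -
  have "T \<in> transversal_spaces H k (points_spanned_by U) lsec \<longleftrightarrow> is_transversal T" for T
  proof (cases "vec.subspace T")
    case True
    have "k - 1 + 1 = k" using k_ge by simp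
    then show ?thesis
      unfolding transversal_spaces_def is_transversal_def proj_space_def
      using True points_of_Int_spanned_eq_empty_iff[OF True]
        points_of_Int_eq_empty_iff[OF True lsec_subspace] by auto
  next
    case False
    then show ?thesis by (simp add: transversal_spaces_def is_transversal_def proj_space_def)
  qed
  then show ?thesis by blast
qed

lemma card_points_spanned_by: "card (points_spanned_by U) = q ^ k - 1"
proof -
  have "points_spanned_by U = (\<lambda>u. vec.span {u}) ` (U - {0})" by (auto simp: points_spanned_by_def)
  moreover have "inj_on (\<lambda>u. vec.span {u}) (U - {0})"
  proof (rule inj_onI)
    fix u v assume u: "u \<in> U - {0}" and v: "v \<in> U - {0}" and eq: "vec.span {u} = vec.span {v}"
    have "v \<in> vec.span {u}" by (simp add: eq vec.span_base)
    then show "u = v" using span_U[of u v] u v by auto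
  qed
  ultimately show ?thesis using zero_U by (simp add: card_image card_Diff_singleton card_A)
qed

lemma pseudoregulus_lsec:
  assumes deg: "\<And>L. L \<in> lsec \<Longrightarrow> card (points_of L \<inter> points_spanned_by U) = q - 1"
  shows "pseudoregulus H k (points_spanned_by U) lsec"
  unfolding pseudoregulus_def card_field
proof (intro conjI ballI)
  show "card lsec = (q ^ k - 1) div (q - 1)"
  proof -
    have "card lsec * (q - 1) div (q - 1) = card lsec"
      using q_ge by (intro nonzero_mult_div_cancel_right) simp
    then show ?thesis by (simp only: card_lsec)
  qed
  show "pairwise (\<lambda>L M. points_of L \<inter> points_of M = {}) lsec"
  proof (rule pairwiseI)
    fix L M assume "L \<in> lsec" "M \<in> lsec" "L \<noteq> M"
    then show "points_of L \<inter> points_of M = {}"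
      using points_of_Int_eq_empty_iff[OF lsec_subspace lsec_subspace] lsec_Int by simp
  qed
  show "card (transversal_spaces H k (points_spanned_by U) lsec) = 2"
    by (simp add: transversal_spaces_eq card_is_transversal)
qed (use lsec_line lsec_subset_H deg in auto)

end

section \<open>The direction set\<close>

context direction_set
begin

text \<open>Additivity is \<open>sum_three_mem\<close> with one summand \<open>a\<close>,
  scatteredness is \<open>no_three_collinear\<close>, and the line conditions come from
  \<open>card_coset\<close>.\<close>

lemma scattered_group_translate:
  assumes a: "a \<in> A"
  shows "scattered_group ((\<lambda>x. x - a) ` A) q k"
    and "\<And>L. vec.subspace L \<Longrightarrow> card ((\<lambda>x. x - a) ` A \<inter> L) = deg L + 1"
    and "D = points_spanned_by ((\<lambda>x. x - a) ` A)"
proof -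
  let ?U = "(\<lambda>x. x - a) ` A"
  have cU: "card (?U \<inter> L) = deg L + 1" if L: "vec.subspace L" for L
  proof -
    have "?U \<inter> L = (\<lambda>x. x - a) ` {x \<in> A. x - a \<in> L}" by auto
    then have "card (?U \<inter> L) = card {x \<in> A. x - a \<in> L}"
      by (simp add: card_image inj_on_def)
    then show ?thesis using card_coset[OF a L] by simp
  qed
  then show "\<And>L. vec.subspace L \<Longrightarrow> card (?U \<inter> L) = deg L + 1" .
  have add: "(x - a) + (y - a) \<in> ?U" if "x \<in> A" "y \<in> A" for x y
  proof -
    have "a + x + y \<in> A" using sum_three_mem[OF that a] .
    moreover have "(x - a) + (y - a) = (a + x + y) - a"
      by (simp add: vdiff_eq)
    ultimately show ?thesis by blast
  qed
  show "scattered_group ?U q k"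
  proof unfold_locales
    show "card ?U = q ^ k" using card_A by (simp add: card_image inj_on_def)
    show "0 \<in> ?U" using a by force
    show "x + y \<in> ?U" if "x \<in> ?U" "y \<in> ?U" for x y using that add by blast
    show "c = 0 \<or> c = 1" if u: "u \<in> ?U" "u \<noteq> 0" "c *s u \<in> ?U" for u c
    proof -
      obtain x y where x: "x \<in> A" "u = x - a" and y: "y \<in> A" "c *s u = y - a" using u by auto
      have "y - a \<in> vec.span {x - a}" by (auto simp: in_span_singleton x y(2)[symmetric])
      then have "y = a \<or> y = x" using no_three_collinear[OF a x(1) y(1)] u(2) x(2) by auto
      then have "c *s u = 0 \<or> c *s u = 1 *s u" using y x by auto
      then show ?thesis using u(2) by (metis vec.scale_cancel_right vec.scale_eq_0_iff)
    qed
    show "card (?U \<inter> L) \<le> 4 \<or> card (?U \<inter> L) = q" if L: "proj_line L" for L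
      using cU[OF proj_line_subspace[OF L]] deg_cases[OF L] q_ge by auto
    show "L \<inter> M = {0}" if "proj_line L" "card (?U \<inter> L) = q" "proj_line M" "card (?U \<inter> M) = q" "L \<noteq> M" for L M
    proof (rule long_secants_disjoint[OF that(1) _ that(3) _ that(5)])
      show "deg L = q - 1" using cU[OF proj_line_subspace[OF that(1)]] that(2) by simp
      show "deg M = q - 1" using cU[OF proj_line_subspace[OF that(3)]] that(4) by simp
    qed
  qed (rule char2 card_field q_ge k_ge)+
  show "D = points_spanned_by ?U"
  proof
    show "D \<subseteq> points_spanned_by ?U"
    proof
      fix P assume "P \<in> D"
      then obtain x where "x \<in> A" "x \<noteq> a" "P = vec.span {x - a}" using partner_exists[OF a] by metis
      then show "P \<in> points_spanned_by ?U" by (auto simp: points_spanned_by_def)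
    qed
    show "points_spanned_by ?U \<subseteq> D"
      using a span_diff_in_D by (auto simp: points_spanned_by_def)
  qed
qed

end

theorem theorem3p12:
  fixes h k q :: nat
    and H :: "('a::{field,finite} ^ 'n) set"
    and Q D :: "('a ^ 'n) set set"
  assumes "h \<ge> 4" and "k \<ge> 2" and "q = 2 ^ h"
    and "CARD('a) = q" and "CARD('n) = 2 * k + 1"
    and "proj_space (2 * k - 1) H"
    and "Q \<subseteq> affine_points H" and "card Q = q ^ k"
    and "D = directions H Q" and "card D = q ^ k - 1"
    and "\<And>L. proj_line L \<Longrightarrow> card (points_of L \<inter> D) \<in> {0, 1, 3, q - 1}"
  shows "pseudoregulus H k D (secants (q - 1) D) \<and> pseudoregulus_type H h k D"
proof -
  have sH: "vec.subspace H" and dH: "vec.dim H = 2 * k"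
    using assms(2,6) by (auto simp: proj_space_def)
  have "H \<noteq> UNIV"
  proof
    assume "H = UNIV"
    then have "vec.dim H = CARD('n)" using vec_dim_card by simp
    then show False using dH assms(5) by simp
  qed
  then obtain e where e: "e \<notin> H" by auto
  \<comment> \<open>Every affine point is \<open>?pt v\<close> for exactly one
    \<open>v \<in> H\<close>, which turns \<open>Q\<close> into the set \<open>A\<close> of
    vectors.\<close>
  let ?pt = "\<lambda>v. vec.span {e + v}"
  define A where "A = {v \<in> H. ?pt v \<in> Q}"
  have inj: "v = w" if vw: "v \<in> H" "w \<in> H" "?pt v = ?pt w" for v w
  proof (rule ccontr)
    assume "v \<noteq> w"
    have "e + v \<in> ?pt w" using vw(3) by (auto intro: vec.span_base)
    then obtain c where c: "e + v = c *s (e + w)" by (auto simp: in_span_singleton)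
    have "(c - 1) *s e = v - c *s w" using c
      by (simp add: vec.scale_right_distrib vec.scale_left_diff_distrib algebra_simps)
    also have "\<dots> \<in> H" using vw by (intro vec.subspace_diff[OF sH] vec.subspace_scale[OF sH])
    finally have *: "(c - 1) *s e \<in> H" .
    have "c - 1 = 0"
    proof (rule ccontr)
      assume "c - 1 \<noteq> 0"
      then have "inverse (c - 1) *s ((c - 1) *s e) = e" by (simp only: vec.scale_scale) simp
      then show False using e vec.subspace_scale[OF sH *, of "inverse (c - 1)"] by simp
    qed
    then show False using c \<open>v \<noteq> w\<close> by simp
  qed
  have Q_eq: "Q = ?pt ` A"
  proof
    show "Q \<subseteq> ?pt ` A"
    proof
      fix P assume P: "P \<in> Q"
      then have "P \<in> affine_points H" using assms(7) by blast
      then obtain p where p: "p \<noteq> 0" "P = vec.span {p}" "\<not> P \<subseteq> H"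
        by (auto simp: affine_points_def proj_point_iff)
      then have pH: "p \<notin> H" by (simp add: span_singleton_subset_iff[OF sH])
      obtain c where c: "p - c *s e \<in> H" using span_affine_in[OF sH _ e] dH assms(5) by auto
      have c0: "c \<noteq> 0" using c pH by auto
      \<comment> \<open>Rescales \<open>p\<close> so that its coefficient at \<open>e\<close>
        becomes 1.\<close>
      define v where "v = inverse c *s (p - c *s e)"
      have v: "v \<in> H" unfolding v_def by (rule vec.subspace_scale[OF sH c])
      have ev: "e + v = inverse c *s p" using c0 by (simp add: v_def vec.scale_right_diff_distrib)
      have "?pt v = P"
        unfolding p(2) using p(1) c0 by (intro span_singleton_eq) (auto simp: ev in_span_singleton)
      then show "P \<in> ?pt ` A" using v P by (auto simp: A_def)
    qed
  qed (auto simp: A_def)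
  have inj_pt: "inj_on ?pt A" using inj by (auto simp: inj_on_def A_def)
  have D_eq: "D = {vec.span {a - b} | a b. a \<in> A \<and> b \<in> A \<and> a \<noteq> b}"
  proof -
    have "D = {direction H (?pt a) (?pt b) | a b. a \<in> A \<and> b \<in> A \<and> ?pt a \<noteq> ?pt b}"
      unfolding assms(9) directions_def Q_eq by blast
    also have "\<dots> = {vec.span {a - b} | a b. a \<in> A \<and> b \<in> A \<and> a \<noteq> b}"
    proof -
      have "direction H (?pt a) (?pt b) = vec.span {a - b}" if "a \<in> A" "b \<in> A" for a b
        using that direction_affine[OF sH e] by (simp add: A_def)
      moreover have "?pt a \<noteq> ?pt b \<longleftrightarrow> a \<noteq> b" if "a \<in> A" "b \<in> A" for a b
        using inj_pt that by (auto dest: inj_onD)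
      ultimately show ?thesis by (intro Collect_cong) metis
    qed
    finally show ?thesis .
  qed
  have "proj_point P" if "P \<in> D" for P using that by (force simp: D_eq proj_point_iff)
  then have points: "points_of L \<inter> D = {P \<in> D. P \<subseteq> L}" for L
    by (auto simp: points_of_def)
  interpret A: direction_set A q k D
  proof
    show "(1::'a) + 1 = 0" using assms(3,4) by (intro finite_field_two_eq_zero[of h]) simp
    have "(2::nat) ^ 4 \<le> 2 ^ h" using assms(1) by (intro power_increasing) auto
    then show "16 \<le> q" using assms(3) by simp
    show "card A = q ^ k" using assms(8) card_image[OF inj_pt] Q_eq by simp
    show "card {P \<in> D. P \<subseteq> L} \<in> {0, 1, 3, q - 1}" if "proj_line L" for L
      using assms(11)[OF that] by (simp only: points)
  qed (fact assms(4) assms(2) D_eq assms(10))+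
  obtain a where a: "a \<in> A" by (rule A.A_nonempty)
  define U where "U = (\<lambda>x. x - a) ` A"
  interpret U: scattered_group U q k
    unfolding U_def by (rule A.scattered_group_translate(1)[OF a])
  interpret U: scattered_group_in_space U q k H
  proof
    show "U \<subseteq> H" using a by (auto simp: U_def A_def intro: vec.subspace_diff[OF sH])
  qed (fact sH dH)+
  have DU: "D = points_spanned_by U"
    unfolding U_def by (rule A.scattered_group_translate(3)[OF a])
  \<comment> \<open>The extra 1 is the zero vector, so secants with \<open>q - 1\<close> directions
    are the lines with \<open>q\<close> elements of \<open>U\<close>.\<close>
  have degU: "card (points_of L \<inter> D) + 1 = card (U \<inter> L)" if "proj_line L" for L
    using A.scattered_group_translate(2)[OF a proj_line_subspace[OF that]]
    by (simp add: points A.deg_def U_def)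
  have "secants (q - 1) D = U.lsec"
    using degU U.q_ge by (fastforce simp: secants_def U.lsec_def)
  moreover have "pseudoregulus H k D U.lsec"
    unfolding DU
  proof (rule U.pseudoregulus_lsec)
    show "card (points_of L \<inter> points_spanned_by U) = q - 1" if "L \<in> U.lsec" for L
      using degU[OF U.lsec_line[OF that]] U.lsec_card[OF that] by (simp add: DU)
  qed
  moreover have "scattered_f2_linear_set H (h * k) D"
    unfolding scattered_f2_linear_set_def
    using U.H(3) U.f2_subspace_U U.f2_dim_U[OF assms(3)] DU U.card_points_spanned_by assms(3)
    by (auto simp: power_mult)
  ultimately show ?thesis by (auto simp: pseudoregulus_type_def)
qed

end
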